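(* Let $(X,T)$ be a topological dynamical system satisfying the almost product property, and let $K\subseteq\mathcal{M}(X,T)$ be a nonempty compact connected set. Then: (1) for any non-empty open set $U\subseteq X$ with $U\cap C_T(X)\neq\emptyset$, $$h_{\mathrm{top}}^{UC}\big(T,G_K\cap U\cap\{x\in X: C_T(X)\subset\omega_T(x)\}\big)=h_{\mathrm{top}}^{UC}\big(T,G_K\cap\{x\in X: C_T(X)\subset\omega_T(x)\}\big)=h_{\mathrm{top}}^{UC}(T,G_K\cap U)=h_{\mathrm{top}}^{UC}(T,G_K)=h_{\mathrm{top}}(T,X);$$ (2) in particular, if further there is an invariant measure $\mu\in\mathcal{M}(X,T)$ with full support, i.e. $S_\mu=X$, then for any non-empty open set $U\subseteq X$, $$h_{\mathrm{top}}^{UC}(T,G_K\cap U)=h_{\mathrm{top}}^{UC}(T,G_K^T\cap U)=h_{\mathrm{top}}^{UC}(T,G_K)=h_{\mathrm{top}}^{UC}(T,G_K^T)=h_{\mathrm{top}}(T,X).$$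
   Context: A topological dynamical system $(X,T)$ is a compact metric space $(X,d)$ with a continuous map $T:X\to X$. $\mathcal{M}(X,T)$ is the space of $T$-invariant Borel probability measures with the weak$^*$ topology. For $x\in X$, $M_x$ is the set of weak$^*$ accumulation points of the sequence $\frac1n\sum_{i=0}^{n-1}\delta_{T^ix}$, and the saturated set of $K$ is $G_K=\{x\in X: M_x=K\}$. $Tran$ is the set of transitive points (points with dense forward orbit) and $G_K^T=G_K\cap Tran$. The omega limit set is $\omega_T(x)=\bigcap_{n\ge0}\overline{\bigcup_{k\ge n}\{T^kx\}}$. The support of $\mu$ is $S_\mu=\{x\in X:\mu(V)>0\text{ for every neighborhood }V\text{ of }x\}$ and the measure center is $C_T(X)=\overline{\bigcup_{\mu\in\mathcal{M}(X,T)}S_\mu}$. Upper capacity entropy: put $d_n(x,y)=\max_{0\le k\le n-1}d(T^kx,T^ky)$. For nonempty $Z\subseteq X$ let $s_n(Z,\epsilon)$ be the largest cardinality of a set $E\subseteq Z$ such that $d_n(x,y)>\epsilon$ for all distinct $x,y\in E$; then $h_{\mathrm{top}}^{UC}(T,Z)=\lim_{\epsilon\to0}\limsup_{n\to\infty}\frac1n\log s_n(Z,\epsilon)$. $h_{\mathrm{top}}(T,X)=h^{UC}_{\mathrm{top}}(T,X)$ is the classical topological entropy. Almost product property: a blowup function is a nondecreasing unbounded map $g:\mathbb{N}\to\mathbb{N}$ with $g(n)<n$ (for $n\geq 1$) and $g(n)/n\to0$. With $\Lambda_n=\{0,\dots,n-1\}$, set $B_n(g;x,\epsilon)=\{y\in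 X:\exists\Lambda\subseteq\Lambda_n,\ \sharp(\Lambda_n\setminus\Lambda)\le g(n),\ \max_{j\in\Lambda}d(T^jx,T^jy)\le\epsilon\}$. $(X,T)$ satisfies the almost product property if there are a blowup function $g$ and a nonincreasing function $m:\mathbb{R}^+\to\mathbb{N}$ such that for any $k\ge2$, any $x_1,\dots,x_k\in X$, any $\epsilon_1,\dots,\epsilon_k>0$ and any integers $n_1\ge m(\epsilon_1),\dots,n_k\ge m(\epsilon_k)$, one has $\bigcap_{j=1}^kT^{-M_{j-1}}B_{n_j}(g;x_j,\epsilon_j)\neq\emptyset$, where $M_0=0$ and $M_i=n_1+\dots+n_i$. *)

theory Defs
  imports "HOL-Probability.Probability"
begin

section \<open>Invariant measures and the weak* topology\<close>

definition borel_prob :: "'a::topological_space measure set" where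
  "borel_prob = {\<mu>. sets \<mu> = sets borel \<and> prob_space \<mu>}"

definition invariant_measures :: "('a::topological_space \<Rightarrow> 'a) \<Rightarrow> 'a measure set" where
  "invariant_measures T = {\<mu> \<in> borel_prob. distr \<mu> borel T = \<mu>}"

text \<open>
  The coarsest topology on the Borel probability measures making \<open>\<mu> \<mapsto> \<integral>f d\<mu>\<close> continuous for
  every continuous real function \<open>f\<close>.  It is used for compact spaces only, where every such
  \<open>f\<close> is bounded.  Its restriction to the invariant measures is the weak* topology there;
  compactness and connectedness of a subset do not depend on the ambient space.
\<close>

definition weak_star :: "'a::topological_space measure topology" where
  "weak_star = topology_generated_by
     {{\<mu> \<in> borel_prob. integral\<^sup>L \<mu> f \<in> V} | (f :: 'a \<Rightarrow> real) V. continuous_on UNIV f \<and> open V}"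

lemma topspace_weak_star: "topspace weak_star = borel_prob"
proof -
  have "borel_prob = {\<mu> \<in> borel_prob. integral\<^sup>L \<mu> (\<lambda>_::'a. 0::real) \<in> UNIV}" by simp
  then have "(borel_prob :: 'a measure set) \<in>
     {{\<mu> \<in> borel_prob. integral\<^sup>L \<mu> f \<in> V} | (f :: 'a \<Rightarrow> real) V. continuous_on UNIV f \<and> open V}"
    using continuous_on_const open_UNIV by blast
  then show ?thesis
    unfolding weak_star_def topology_generated_by_topspace by blast
qed

text \<open>\<open>(1/n) \<Sum>i<n. \<delta>\<^bsub>T\<^sup>i x\<^esub>\<close>; for \<open>n = 0\<close> this is the zero measure.\<close>

definition empirical :: "('a::topological_space \<Rightarrow> 'a) \<Rightarrow> 'a \<Rightarrow> nat \<Rightarrow> 'a measure" where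
  "empirical T x n = measure_of UNIV (sets borel)
     (\<lambda>A. ennreal (1 / real n) * (\<Sum>i<n. emeasure (return borel ((T ^^ i) x)) A))"

lemma sets_empirical: "sets (empirical T x n) = sets borel"
  using sets.sigma_sets_eq[of "borel :: 'a::topological_space measure"]
  by (simp add: empirical_def)

lemma emeasure_empirical:
  assumes "A \<in> sets borel"
  shows "emeasure (empirical T x n) A =
    ennreal (1 / real n) * (\<Sum>i<n. emeasure (return borel ((T ^^ i) x)) A)"
proof (rule emeasure_measure_of[OF empirical_def])
  show "A \<in> sets (empirical T x n)" using assms by (simp add: sets_empirical)
  show "positive (sets (empirical T x n))
     (\<lambda>A. ennreal (1 / real n) * (\<Sum>i<n. emeasure (return borel ((T ^^ i) x)) A))"
    by (simp add: positive_def)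
  show "countably_additive (sets (empirical T x n))
     (\<lambda>A. ennreal (1 / real n) * (\<Sum>i<n. emeasure (return borel ((T ^^ i) x)) A))"
  proof (rule countably_additiveI)
    fix B :: "nat \<Rightarrow> 'a set"
    assume B: "range B \<subseteq> sets (empirical T x n)" "disjoint_family B"
    have "(\<Sum>k. emeasure (return borel ((T ^^ i) x)) (B k)) =
        emeasure (return borel ((T ^^ i) x)) (\<Union> (range B))" for i
      using B by (intro suminf_emeasure) (auto simp: sets_empirical)
    then show "(\<Sum>k. ennreal (1 / real n) * (\<Sum>i<n. emeasure (return borel ((T ^^ i) x)) (B k))) =
        ennreal (1 / real n) * (\<Sum>i<n. emeasure (return borel ((T ^^ i) x)) (\<Union> (range B)))"
      by (simp add: ennreal_suminf_cmult suminf_sum summableI del: emeasure_return)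
  qed
qed auto

lemma empirical_borel_prob:
  assumes "n > 0"
  shows "empirical T x n \<in> borel_prob"
proof -
  have "space (empirical T x n) = UNIV"
    using sets_eq_imp_space_eq[OF sets_empirical[of T x n]] by simp
  moreover have "ennreal (1 / real n) * of_nat n = 1"
    using assms by (simp add: ennreal_of_nat_eq_real_of_nat flip: ennreal_mult)
  ultimately show ?thesis
    by (auto simp: borel_prob_def sets_empirical emeasure_empirical intro!: prob_spaceI)
qed

text \<open>Accumulation points of the \<^emph>\<open>sequence\<close>, so a value taken infinitely often is one.\<close>

definition acc_measures :: "('a::topological_space \<Rightarrow> 'a) \<Rightarrow> 'a \<Rightarrow> 'a measure set" where
  "acc_measures T x = {\<mu> \<in> borel_prob.
     \<forall>\<U>. openin weak_star \<U> \<and> \<mu> \<in> \<U> \<longrightarrow> (\<exists>\<^sub>\<infinity>n. empirical T x n \<in> \<U>)}"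

definition saturated_set :: "('a::topological_space \<Rightarrow> 'a) \<Rightarrow> 'a measure set \<Rightarrow> 'a set" where
  "saturated_set T K = {x. acc_measures T x = K}"

definition supp :: "'a::topological_space measure \<Rightarrow> 'a set" where
  "supp \<mu> = {x. \<forall>V. open V \<and> x \<in> V \<longrightarrow> emeasure \<mu> V > 0}"

definition measure_center :: "('a::topological_space \<Rightarrow> 'a) \<Rightarrow> 'a set" where
  "measure_center T = closure (\<Union>\<mu>\<in>invariant_measures T. supp \<mu>)"


section \<open>Orbits\<close>

definition transitive_points :: "('a::topological_space \<Rightarrow> 'a) \<Rightarrow> 'a set" where
  "transitive_points T = {x. closure (range (\<lambda>n. (T ^^ n) x)) = UNIV}"

definition omega_limit :: "('a::topological_space \<Rightarrow> 'a) \<Rightarrow> 'a \<Rightarrow> 'a set" where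
  "omega_limit T x = (\<Inter>n. closure (\<Union>k\<in>{n..}. {(T ^^ k) x}))"


section \<open>Upper capacity entropy\<close>

text \<open>Meaningful for \<open>n \<ge> 1\<close>; the (unspecified) value at \<open>n = 0\<close> does not affect the entropy.\<close>

definition bowen_dist :: "('a::metric_space \<Rightarrow> 'a) \<Rightarrow> nat \<Rightarrow> 'a \<Rightarrow> 'a \<Rightarrow> real" where
  "bowen_dist T n x y = (MAX k\<in>{..<n}. dist ((T ^^ k) x) ((T ^^ k) y))"

text \<open>
  On a compact space with \<open>T\<close> continuous, \<open>n \<ge> 1\<close> and \<open>\<epsilon> > 0\<close>, separated sets are finite with
  uniformly bounded cardinality, so the supremum is a maximum.
\<close>

definition max_separated :: "('a::metric_space \<Rightarrow> 'a) \<Rightarrow> nat \<Rightarrow> 'a set \<Rightarrow> real \<Rightarrow> nat" where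
  "max_separated T n Z \<epsilon> = Sup {card E | E. E \<subseteq> Z \<and> finite E \<and>
     (\<forall>x\<in>E. \<forall>y\<in>E. x \<noteq> y \<longrightarrow> bowen_dist T n x y > \<epsilon>)}"

text \<open>
  The convention \<open>log 0 = -\<infinity>\<close> only concerns \<open>Z = {}\<close>, which then has entropy \<open>-\<infinity>\<close>, whereas a
  nonempty set has entropy \<open>\<ge> 0\<close>.  Hence an equation between the entropy of a set and that of
  the whole space includes the nonemptiness of the set.
\<close>

definition upper_capacity_entropy :: "('a::metric_space \<Rightarrow> 'a) \<Rightarrow> 'a set \<Rightarrow> ereal" where
  "upper_capacity_entropy T Z = Lim (at_right 0) (\<lambda>\<epsilon>. limsup (\<lambda>n.
     let s = max_separated T n Z \<epsilon> in
     if s = 0 then -\<infinity> else ereal (1 / real n * ln (real s))))"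

definition topological_entropy :: "('a::metric_space \<Rightarrow> 'a) \<Rightarrow> ereal" where
  "topological_entropy T = upper_capacity_entropy T UNIV"


section \<open>Almost product property\<close>

text \<open>Since \<open>g 1 = 0\<close>, monotonicity at \<open>0\<close> merely fixes \<open>g 0 = 0\<close>.\<close>

definition blowup :: "(nat \<Rightarrow> nat) \<Rightarrow> bool" where
  "blowup g \<longleftrightarrow> mono g \<and> \<not> bdd_above (range g) \<and> (\<forall>n\<ge>1. g n < n) \<and>
     (\<lambda>n. real (g n) / real n) \<longlonglongrightarrow> 0"

definition blowup_ball ::
  "('a::metric_space \<Rightarrow> 'a) \<Rightarrow> (nat \<Rightarrow> nat) \<Rightarrow> nat \<Rightarrow> 'a \<Rightarrow> real \<Rightarrow> 'a set" where
  "blowup_ball T g n x \<epsilon> = {y. \<exists>\<Lambda>\<subseteq>{..<n}. card ({..<n} - \<Lambda>) \<le> g n \<and>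
     (\<forall>j\<in>\<Lambda>. dist ((T ^^ j) x) ((T ^^ j) y) \<le> \<epsilon>)}"

definition almost_product_property :: "('a::metric_space \<Rightarrow> 'a) \<Rightarrow> bool" where
  "almost_product_property T \<longleftrightarrow>
     (\<exists>g (m :: real \<Rightarrow> nat). blowup g \<and> antimono_on {0<..} m \<and>
       (\<forall>k\<ge>2. \<forall>(x :: nat \<Rightarrow> 'a) (\<epsilon> :: nat \<Rightarrow> real) (n :: nat \<Rightarrow> nat).
          (\<forall>j\<in>{1..k}. \<epsilon> j > 0 \<and> n j \<ge> m (\<epsilon> j)) \<longrightarrow>
          (\<Inter>j\<in>{1..k}. (T ^^ (\<Sum>i=1..j-1. n i)) -` blowup_ball T g (n j) (x j) (\<epsilon> j)) \<noteq> {}))"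

end

theory Submission
  imports Defs
begin

text \<open>
  Upper capacity entropy is monotone in the set, so every equation of the theorem follows from one
  inequality: if \<open>U\<close> is open and meets the measure center \<open>C\<close>, then the set \<open>Z\<close> of all points of
  \<open>U \<inter> G\<^sub>K\<close> whose \<open>\<omega>\<close>-limit set contains \<open>C\<close> has at least the entropy of the whole system. For the
  second part, a measure of full support gives \<open>C = X\<close>, and a point whose \<open>\<omega>\<close>-limit set is \<open>X\<close> is
  transitive.

  The inequality holds because a separated set of order \<open>n\<close> only looks at about \<open>n\<close> iterates, whereas
  membership in \<open>Z\<close> is a condition on a bounded initial piece of the orbit (the visit to \<open>U\<close>) and on
  its behaviour at infinity. The almost product property makes these pieces independent: there is
  an orbit that follows a segment of fixed length \<open>N\<close> meeting \<open>U\<close>, then an arbitrary segment of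
  length \<open>n\<close>, and then a fixed infinite tail that forces the accumulation measures to be \<open>K\<close> and the
  \<open>\<omega>\<close>-limit set to contain \<open>C\<close> (\<open>saturated_shadowing_points\<close>). Starting the orbit at its visit to
  \<open>U\<close> changes neither asymptotic property. Each middle segment thus yields a point of \<open>Z\<close>, and a point
  of \<open>Z\<close> determines the segment up to the position and content of \<open>g n\<close> errors, that is, up to
  \<open>e\<^bsup>o(n)\<^esup>\<close> possibilities (\<open>separated_count\<close>, \<open>entropy_lower_bound\<close>).

  The tail (\<open>tail_exists\<close>) is built as follows. The weak* topology is described by the integrals of
  countably many functions \<open>\<phi> i\<close>, hence by a map \<open>coords\<close> into the metric space of real sequences. The
  image of \<open>K\<close> is compact and connected, so it contains a sequence of points with consecutive
  distances tending to \<open>0\<close> that returns infinitely often to every neighbourhood of every point of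
  the image (\<open>slow_dense_sequence\<close>). Its \<open>k\<close>-th term, the coordinates of \<open>\<alpha> k \<in> K\<close>, is realised up to \<open>1 / (k + 1)\<close>
  by a finite block of orbit segments of equal length \<open>n\<close>: by invariance the Birkhoff sums of length
  \<open>n\<close> have \<open>\<alpha> k\<close>-mean \<open>n * \<integral>f d(\<alpha> k)\<close>, so starting points can be chosen one after another such that
  each new deviation has inner product at most \<open>0\<close> with the sum of the earlier ones, and the total deviation of \<open>j\<close>
  segments is only of order \<open>sqrt j\<close> (\<open>balanced_sample\<close>). One segment of the block may be prescribed,
  and it is used to visit a given open set that meets \<open>C\<close> (\<open>block_exists\<close>). The \<open>k\<close>-th block is
  repeated so often that everything before it, and one copy of the next block, is negligible. Then the
  average up to any time in stage \<open>k\<close> is close to the coordinates of \<open>\<alpha> k\<close>, and its cluster points are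
  exactly the points of \<open>coords ` K\<close>.
\<close>

section \<open>Dense and slowly varying sequences in compact metric spaces\<close>

lemma compact_finite_net:
  fixes Q :: "'a::metric_space set"
  assumes "compact Q" "e > 0"
  obtains A where "finite A" "A \<subseteq> Q" "\<And>x. x \<in> Q \<Longrightarrow> \<exists>p\<in>A. dist x p < e"
proof -
  have "Q \<subseteq> (\<Union>p\<in>Q. ball p e)" using assms(2) by auto
  then obtain A where "A \<subseteq> Q" "finite A" "Q \<subseteq> (\<Union>p\<in>A. ball p e)"
    using compactE_image[OF assms(1), of Q "\<lambda>p. ball p e"] by auto
  then show ?thesis using that[of A] by (fastforce simp: dist_commute)
qed

text \<open>A sequence that lists a countable dense subset of \<open>Q\<close> with every element repeated infinitely often.\<close>

lemma dense_recurrent_sequence: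
  fixes Q :: "'a::metric_space set"
  assumes "compact Q" "Q \<noteq> {}"
  shows "\<exists>c :: nat \<Rightarrow> 'a. (\<forall>k. c k \<in> Q) \<and> (\<forall>q\<in>Q. \<forall>\<delta>>0. \<exists>\<^sub>\<infinity>k. dist (c k) q < \<delta>)"
proof -
  have "\<exists>A. finite A \<and> A \<subseteq> Q \<and> (\<forall>x\<in>Q. \<exists>p\<in>A. dist x p < 1 / real (Suc n))" for n
    by (rule compact_finite_net[OF assms(1), of "1 / real (Suc n)"]) auto
  then obtain A where A: "\<And>n. finite (A n)" "\<And>n. A n \<subseteq> Q"
    "\<And>n x. x \<in> Q \<Longrightarrow> \<exists>p\<in>A n. dist x p < 1 / real (Suc n)"
    by metis
  define D where "D = (\<Union>n. A n)"
  have D: "countable D" "D \<subseteq> Q" "D \<noteq> {}"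
  proof -
    show "countable D" using A(1) by (simp add: D_def countable_finite)
    show "D \<subseteq> Q" using A(2) unfolding D_def by blast
    obtain q where "q \<in> Q" using assms(2) by blast
    then show "D \<noteq> {}" using A(3)[of q 0] unfolding D_def by blast
  qed
  \<comment> \<open>the second component of the decoded pair is a counter that repeats each element\<close>
  define c where "c k = from_nat_into D (fst (prod_decode k))" for k
  show ?thesis
  proof (intro exI[of _ c] conjI allI ballI impI)
    show "c k \<in> Q" for k
      using D from_nat_into[of D] unfolding c_def by blast
    fix q \<delta> assume q: "q \<in> Q" and "\<delta> > (0::real)"
    then obtain n where n: "1 / real (Suc n) < \<delta>"
      using nat_approx_posE by blast
    obtain p where p: "p \<in> A n" "dist q p < 1 / real (Suc n)" using A(3)[OF q] by blast
    then have "p \<in> D" unfolding D_def by blast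
    then obtain i where i: "from_nat_into D i = p"
      using from_nat_into_surj D by metis
    show "\<exists>\<^sub>\<infinity>k. dist (c k) q < \<delta>"
      unfolding INFM_nat_le
    proof
      fix m
      have "dist (c (prod_encode (i, m))) q < \<delta>"
        using p n i by (simp add: c_def dist_commute)
      then show "\<exists>k\<ge>m. dist (c k) q < \<delta>"
        using le_prod_encode_2 by blast
    qed
  qed
qed

text \<open>The points that can be reached from \<open>x\<close> by steps shorter than \<open>e\<close> form a relatively clopen set.\<close>

lemma connected_chain:
  fixes Q :: "'a::metric_space set"
  assumes "connected Q" "x \<in> Q" "y \<in> Q" "e > 0"
  shows "(x, y) \<in> {(u, v). u \<in> Q \<and> v \<in> Q \<and> dist u v < e}\<^sup>*"
proof -
  let ?R = "{(u, v). u \<in> Q \<and> v \<in> Q \<and> dist u v < e}"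
  have "sym ?R" by (auto simp: sym_def dist_commute)
  show ?thesis
  proof (rule connected_equivalence_relation[OF assms(1-3), where R = "\<lambda>x y. (x, y) \<in> ?R\<^sup>*"])
    show "\<And>x y. (x, y) \<in> ?R\<^sup>* \<Longrightarrow> x \<in> Q \<Longrightarrow> y \<in> Q \<Longrightarrow> (y, x) \<in> ?R\<^sup>*"
      using sym_rtrancl[OF \<open>sym ?R\<close>] by (meson symD)
    fix a assume a: "a \<in> Q"
    have "openin (top_of_set Q) (Q \<inter> ball a e)" by auto
    moreover have "\<forall>x\<in>Q \<inter> ball a e. (a, x) \<in> ?R\<^sup>*" using a by auto
    ultimately show "\<exists>T. openin (top_of_set Q) T \<and> a \<in> T \<and> (\<forall>x\<in>T. (a, x) \<in> ?R\<^sup>*)"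
      using a assms(4) by (intro exI[of _ "Q \<inter> ball a e"]) auto
  qed (auto intro: rtrancl_trans)
qed

text \<open>
  Join consecutive terms \<open>c n\<close>, \<open>c (Suc n)\<close> of a dense recurrent sequence by chains with steps shorter
  than \<open>1 / (n + 2)\<close> and run through all the chains in succession. The concatenation is generated by
  iterating a map on pairs of the current point and the index of the current target.
\<close>

lemma slow_dense_sequence:
  fixes Q :: "'a::metric_space set"
  assumes "compact Q" "connected Q" "Q \<noteq> {}"
  shows "\<exists>q :: nat \<Rightarrow> 'a. (\<forall>k. q k \<in> Q) \<and> (\<lambda>k. dist (q k) (q (Suc k))) \<longlonglongrightarrow> 0 \<and>
    (\<forall>p\<in>Q. \<forall>\<delta>>0. \<exists>\<^sub>\<infinity>k. dist (q k) p < \<delta>)"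
proof -
  from dense_recurrent_sequence[OF assms(1,3)] obtain c :: "nat \<Rightarrow> 'a" where
    c: "\<forall>k. c k \<in> Q" "\<forall>q\<in>Q. \<forall>\<delta>>0. \<exists>\<^sub>\<infinity>k. dist (c k) q < \<delta>"
    by (elim exE conjE)
  note c = c(1)[rule_format] c(2)[rule_format]
  define R where "R n = {(u, v). u \<in> Q \<and> v \<in> Q \<and> dist u v < 1 / real (Suc n)}" for n
  \<comment> \<open>length of a shortest chain to the target, the termination measure of the walk\<close>
  define d where "d n x = (LEAST m. (x, c n) \<in> R n ^^ m)" for n x
  have closer: "\<exists>y. (x, y) \<in> R n \<and> d n y < d n x" if "x \<in> Q" "x \<noteq> c n" for x n
  proof -
    have "(x, c n) \<in> (R n)\<^sup>*"
      using connected_chain[OF assms(2) that(1) c(1), of "1 / real (Suc n)"] unfolding R_def by simp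
    then have ex: "\<exists>m. (x, c n) \<in> R n ^^ m" using rtrancl_power by blast
    have "(x, c n) \<in> R n ^^ d n x" unfolding d_def by (rule LeastI_ex[OF ex])
    moreover from this that(2) obtain m where m: "d n x = Suc m" by (cases "d n x") auto
    ultimately obtain y where "(x, y) \<in> R n" "(y, c n) \<in> R n ^^ m"
      by (metis relpow_Suc_E2)
    moreover from this have "d n y \<le> m" unfolding d_def by (simp add: Least_le)
    ultimately show ?thesis using m by auto
  qed
  define step where "step = (\<lambda>(x, n). if x = c n then (x, Suc n)
    else (SOME y. (x, y) \<in> R n \<and> d n y < d n x, n))"
  have step_eq: "step (c n, n) = (c n, Suc n)" for n by (simp add: step_def)
  have step_ne: "\<exists>y. step (x, n) = (y, n) \<and> (x, y) \<in> R n \<and> d n y < d n x"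
    if "x \<in> Q" "x \<noteq> c n" for x n
    using someI_ex[OF closer[OF that]] that(2) by (simp add: step_def)
  define s where "s k = (step ^^ k) (c 0, 0)" for k
  have s0: "s 0 = (c 0, 0)" and sS: "s (Suc k) = step (s k)" for k
    by (simp_all add: s_def)
  have sQ: "fst (s k) \<in> Q" for k
  proof (induction k)
    case (Suc k)
    obtain x n where xn: "s k = (x, n)" by (cases "s k")
    show ?case
    proof (cases "x = c n")
      case False
      then obtain y where "step (x, n) = (y, n)" "(x, y) \<in> R n"
        using step_ne[of x n] Suc xn by auto
      then show ?thesis by (simp add: sS xn R_def)
    qed (simp add: sS xn step_eq c)
  qed (simp add: s0 c)
  have small: "dist (fst (s k)) (fst (s (Suc k))) < 1 / real (Suc (snd (s k)))
      \<and> snd (s k) \<le> snd (s (Suc k))" for k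
  proof -
    obtain x n where xn: "s k = (x, n)" by (cases "s k")
    show ?thesis
    proof (cases "x = c n")
      case False
      then obtain y where "step (x, n) = (y, n)" "(x, y) \<in> R n"
        using step_ne[of x n] sQ[of k] xn by auto
      then show ?thesis by (simp add: sS xn R_def)
    qed (simp add: sS xn step_eq)
  qed
  have reach: "\<exists>k'\<ge>k. s k' = (c n, n)" if "s k = (x, n)" for k x n
    using that
  proof (induction "d n x" arbitrary: k x rule: less_induct)
    case less
    show ?case
    proof (cases "x = c n")
      case False
      then obtain y where y: "step (x, n) = (y, n)" "d n y < d n x"
        using step_ne[of x n] sQ[of k] less.prems by auto
      then have "s (Suc k) = (y, n)" by (simp add: sS less.prems)
      then obtain k' where "k' \<ge> Suc k" "s k' = (c n, n)" using less.hyps[OF y(2)] by metis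
      then show ?thesis by (intro exI[of _ k']) simp
    qed (use less.prems in auto)
  qed
  have visit: "\<exists>k\<ge>n. s k = (c n, n)" for n
  proof (induction n)
    case 0
    then show ?case using s0 by blast
  next
    case (Suc n)
    then obtain k where k: "k \<ge> n" "s k = (c n, n)" by blast
    then have "s (Suc k) = (c n, Suc n)" by (simp add: sS step_eq)
    then obtain k' where "k' \<ge> Suc k" "s k' = (c (Suc n), Suc n)" using reach by metis
    then show ?case using k(1) by (intro exI[of _ k']) simp
  qed
  have mono: "mono (\<lambda>k. snd (s k))" using small by (simp add: incseq_SucI)
  have "filterlim (\<lambda>k. snd (s k)) at_top sequentially"
    unfolding filterlim_at_top eventually_sequentially
    using visit mono by (metis monoD snd_conv)
  then have "(\<lambda>k. 1 / real (Suc (snd (s k)))) \<longlonglongrightarrow> 0"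
    using LIMSEQ_inverse_real_of_nat filterlim_compose by (fastforce simp: inverse_eq_divide)
  then have lim: "(\<lambda>k. dist (fst (s k)) (fst (s (Suc k)))) \<longlonglongrightarrow> 0"
    by (rule Lim_null_comparison[rotated]) (use small in \<open>auto intro!: always_eventually less_imp_le\<close>)
  show ?thesis
  proof (intro exI[of _ "\<lambda>k. fst (s k)"] conjI allI ballI impI sQ lim)
    fix p \<delta> assume p: "p \<in> Q" "\<delta> > (0::real)"
    show "\<exists>\<^sub>\<infinity>k. dist (fst (s k)) p < \<delta>"
      unfolding INFM_nat_le
    proof
      fix m
      obtain n where n: "n \<ge> m" "dist (c n) p < \<delta>"
        using c(2)[OF p] unfolding INFM_nat_le by blast
      obtain k where "k \<ge> n" "s k = (c n, n)" using visit by blast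
      then show "\<exists>k\<ge>m. dist (fst (s k)) p < \<delta>" using n by (intro exI[of _ k]) auto
    qed
  qed
qed

section \<open>The metric on real sequences\<close>

text \<open>One term of the series that defines the distance.\<close>

lemma coordinate_le_dist_fun:
  fixes x y :: "nat \<Rightarrow> real"
  shows "(1 / 2) ^ to_nat i * min \<bar>x i - y i\<bar> 1 \<le> dist x y"
proof -
  have "summable (\<lambda>n. (1/2)^n * min (dist (x (from_nat n)) (y (from_nat n))) 1)"
    by (rule summable_comparison_test'[of "\<lambda>n. (1/2)^n"]) (auto simp: summable_geometric_iff)
  from sum_le_suminf[OF this, of "{to_nat i}"] show ?thesis
    by (simp add: dist_fun_def dist_real_def)
qed

lemma coordinate_tendsto_0:
  fixes u v :: "nat \<Rightarrow> nat \<Rightarrow> real"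
  assumes "(\<lambda>n. dist (u n) (v n)) \<longlonglongrightarrow> 0"
  shows "(\<lambda>n. \<bar>u n i - v n i\<bar>) \<longlonglongrightarrow> 0"
proof (rule LIMSEQ_I)
  fix e :: real assume e: "e > 0"
  let ?c = "(1 / 2 :: real) ^ to_nat i"
  have "\<forall>\<^sub>F n in sequentially. dist (u n) (v n) < ?c * min e 1"
    using e by (intro order_tendstoD(2)[OF assms]) simp
  then have "\<forall>\<^sub>F n in sequentially. \<bar>u n i - v n i\<bar> < e"
  proof eventually_elim
    case (elim n)
    then have "?c * min \<bar>u n i - v n i\<bar> 1 < ?c * min e 1"
      using coordinate_le_dist_fun[of i "u n" "v n"] by linarith
    then have "min \<bar>u n i - v n i\<bar> 1 < min e 1" by simp
    then show ?case by linarith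
  qed
  then show "\<exists>no. \<forall>n\<ge>no. norm (\<bar>u n i - v n i\<bar> - 0) < e"
    by (simp add: eventually_sequentially)
qed

lemma dist_fun_tendsto_0:
  fixes u v :: "nat \<Rightarrow> nat \<Rightarrow> real"
  assumes "\<And>i. (\<lambda>n. \<bar>u n i - v n i\<bar>) \<longlonglongrightarrow> 0"
  shows "(\<lambda>n. dist (u n) (v n)) \<longlonglongrightarrow> 0"
proof (rule LIMSEQ_I)
  fix e :: real assume e: "e > 0"
  obtain N where N: "(1 / 2 :: real) ^ N < e / 2"
    using real_arch_pow_inv[of "e / 2" "1 / 2"] e by auto
  \<comment> \<open>the distance enumerates the index type \<open>nat\<close> by \<open>from_nat\<close>, which need not be the identity\<close>
  have "\<forall>\<^sub>F n in sequentially. \<forall>i\<in>from_nat ` {..N}. \<bar>u n i - v n i\<bar> < e / 4"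
    using assms e by (intro eventually_ball_finite) (auto intro!: order_tendstoD)
  then have "\<forall>\<^sub>F n in sequentially. dist (u n) (v n) < e"
  proof eventually_elim
    case (elim n)
    have "Max {dist (u n (from_nat k)) (v n (from_nat k)) |k. k \<le> N} < e / 4"
      using elim by (subst Max_less_iff) (auto simp: dist_real_def)
    with dist_fun_le_dist_first_terms[of "u n" "v n" N] N show ?case by linarith
  qed
  then show "\<exists>no. \<forall>n\<ge>no. norm (dist (u n) (v n) - 0) < e"
    by (simp add: eventually_sequentially)
qed

section \<open>Countably many coordinates for the weak* topology\<close>

text \<open>
  The empirical measure is the image of the uniform measure on \<open>{..<n}\<close> under \<open>i \<mapsto> T\<^sup>i x\<close>.
\<close>

lemma integral_empirical:
  fixes f :: "'a::topological_space \<Rightarrow> real"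
  assumes "n > 0" "f \<in> borel_measurable borel"
  shows "integral\<^sup>L (empirical T x n) f = (\<Sum>i<n. f ((T ^^ i) x)) / real n"
proof -
  let ?U = "uniform_count_measure {..<n}"
  have meas: "(\<lambda>i. (T ^^ i) x) \<in> measurable ?U borel" by (simp add: measurable_def)
  have "empirical T x n = distr ?U borel (\<lambda>i. (T ^^ i) x)"
  proof (rule measure_eqI)
    show "sets (empirical T x n) = sets (distr ?U borel (\<lambda>i. (T ^^ i) x))"
      by (simp add: sets_empirical)
    fix A assume "A \<in> sets (empirical T x n)"
    then have A: "A \<in> sets borel" by (simp add: sets_empirical)
    let ?S = "(\<lambda>i. (T ^^ i) x) -` A \<inter> {..<n}"
    have "(\<Sum>i<n. indicator A ((T ^^ i) x)) = (of_nat (card ?S) :: ennreal)"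
      by (simp add: indicator_def sum.If_cases vimage_def Int_def conj_commute)
    then have "emeasure (empirical T x n) A = ennreal (1 / real n) * of_nat (card ?S)"
      using A by (simp add: emeasure_empirical)
    also have "\<dots> = ennreal (card ?S / n)"
      using assms(1) by (simp add: ennreal_of_nat_eq_real_of_nat flip: ennreal_mult)
    also have "\<dots> = emeasure ?U ?S"
      by (subst emeasure_uniform_count_measure) auto
    also have "\<dots> = emeasure (distr ?U borel (\<lambda>i. (T ^^ i) x)) A"
      using A meas by (simp add: emeasure_distr space_uniform_count_measure)
    finally show "emeasure (empirical T x n) A = emeasure (distr ?U borel (\<lambda>i. (T ^^ i) x)) A" .
  qed
  then show ?thesis
    using assms meas by (simp add: integral_distr integral_uniform_count_measure)
qed

lemma integrable_continuous_compact:
  fixes f :: "'a::metric_space \<Rightarrow> real"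
  assumes "compact (UNIV :: 'a set)" "continuous_on UNIV f" "\<mu> \<in> borel_prob"
  shows "integrable \<mu> f"
proof -
  interpret prob_space \<mu> using assms(3) by (simp add: borel_prob_def)
  have "bounded (range f)"
    using assms(1,2) compact_continuous_image compact_imp_bounded by blast
  then obtain B where "\<And>x. norm (f x) \<le> B" unfolding bounded_iff by blast
  moreover have "f \<in> borel_measurable \<mu>"
    using assms(2,3) borel_measurable_continuous_onI[of f]
    by (simp add: borel_prob_def cong: measurable_cong_sets)
  ultimately show ?thesis by (intro integrable_const_bound[of _ B]) auto
qed

lemma (in prob_space) abs_integral_diff_le:
  fixes f h :: "'a \<Rightarrow> real"
  assumes "integrable M f" "integrable M h" "\<And>x. \<bar>f x - h x\<bar> \<le> e"
  shows "\<bar>integral\<^sup>L M f - integral\<^sup>L M h\<bar> \<le> e"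
proof -
  have "\<bar>integral\<^sup>L M f - integral\<^sup>L M h\<bar> = \<bar>\<integral>x. f x - h x \<partial>M\<bar>"
    using assms by simp
  also have "\<dots> \<le> (\<integral>x. \<bar>f x - h x\<bar> \<partial>M)"
    by (rule integral_abs_bound)
  also have "\<dots> \<le> (\<integral>x. e \<partial>M)"
    using assms by (intro integral_mono) auto
  finally show ?thesis by (simp add: prob_space)
qed

text \<open>
  The indicator of a closed set \<open>C\<close> is the decreasing limit of the continuous functions
  \<open>max 0 (1 - n * infdist x C)\<close>, and closed sets are an intersection-stable generator.
\<close>

lemma borel_prob_eqI:
  fixes \<mu> \<nu> :: "'a::metric_space measure"
  assumes "\<mu> \<in> borel_prob" "\<nu> \<in> borel_prob"
    and eq: "\<And>f :: 'a \<Rightarrow> real. continuous_on UNIV f \<Longrightarrow> (\<And>x. \<bar>f x\<bar> \<le> 1) \<Longrightarrow> integral\<^sup>L \<mu> f = integral\<^sup>L \<nu> f"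
  shows "\<mu> = \<nu>"
proof -
  interpret \<mu>: prob_space \<mu> using assms(1) by (simp add: borel_prob_def)
  interpret \<nu>: prob_space \<nu> using assms(2) by (simp add: borel_prob_def)
  have sets: "sets \<mu> = sets borel" "sets \<nu> = sets borel" using assms by (auto simp: borel_prob_def)
  have lim: "(\<lambda>n. integral\<^sup>L M (\<lambda>x. max 0 (1 - real n * infdist x C))) \<longlonglongrightarrow> measure M C"
    if C: "closed C" "C \<noteq> {}" and M: "prob_space M" "sets M = sets borel" for C and M :: "'a measure"
  proof -
    interpret prob_space M by fact
    have meas: "(\<lambda>x. max 0 (1 - real n * infdist x C)) \<in> borel_measurable M" for n
    proof -
      have "continuous_on UNIV (\<lambda>x. max 0 (1 - real n * infdist x C))"
        by (intro continuous_intros)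
      then show ?thesis using M(2) borel_measurable_continuous_onI
        by (simp cong: measurable_cong_sets)
    qed
    have "(\<lambda>n. integral\<^sup>L M (\<lambda>x. max 0 (1 - real n * infdist x C))) \<longlonglongrightarrow> integral\<^sup>L M (indicator C)"
    proof (rule integral_dominated_convergence[where w = "\<lambda>_. 1"])
      show "(indicator C :: 'a \<Rightarrow> real) \<in> borel_measurable M"
        using C M(2) by (intro borel_measurable_indicator) auto
      show "AE x in M. (\<lambda>n. max 0 (1 - real n * infdist x C)) \<longlonglongrightarrow> indicator C x"
      proof (rule AE_I2)
        fix x
        show "(\<lambda>n. max 0 (1 - real n * infdist x C)) \<longlonglongrightarrow> indicator C x"
        proof (cases "x \<in> C")
          case False
          then have pos: "infdist x C > 0"
            using C infdist_pos_not_in_closed by blast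
          have "filterlim (\<lambda>n. real n * infdist x C) at_top sequentially"
            using pos filterlim_real_sequentially
            by (intro filterlim_at_top_mult_tendsto_pos[where f = "\<lambda>_. infdist x C" and c = "infdist x C", simplified mult.commute]) auto
          then have "eventually (\<lambda>n. real n * infdist x C \<ge> 1) sequentially"
            unfolding filterlim_at_top by blast
          then have "eventually (\<lambda>n. max 0 (1 - real n * infdist x C) = indicator C x) sequentially"
            by eventually_elim (use False in auto)
          then show ?thesis by (simp add: tendsto_eventually)
        qed auto
      qed
    qed (use meas infdist_nonneg[of _ C] in \<open>auto intro!: mult_nonneg_nonneg\<close>)
    moreover have "integral\<^sup>L M (indicator C) = measure M C"
      using C M(2) by (simp add: sets_eq_imp_space_eq[OF M(2)])
    ultimately show ?thesis by simp
  qed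
  have closed_eq: "emeasure \<mu> C = emeasure \<nu> C" if C: "closed C" for C
  proof (cases "C = {}")
    case False
    have "integral\<^sup>L \<mu> (\<lambda>x. max 0 (1 - real n * infdist x C)) = integral\<^sup>L \<nu> (\<lambda>x. max 0 (1 - real n * infdist x C))" for n
    proof (rule eq)
      show "\<bar>max 0 (1 - real n * infdist x C)\<bar> \<le> 1" for x
        using mult_nonneg_nonneg[OF of_nat_0_le_iff infdist_nonneg, of n x C] by auto
    qed (intro continuous_intros)
    then have "measure \<mu> C = measure \<nu> C"
      using lim[OF C False \<mu>.prob_space_axioms sets(1)] lim[OF C False \<nu>.prob_space_axioms sets(2)]
      by (simp add: LIMSEQ_unique)
    then show ?thesis by (simp add: \<mu>.emeasure_eq_measure \<nu>.emeasure_eq_measure)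
  qed simp
  show ?thesis
  proof (rule measure_eqI_generator_eq[where E = "Collect closed" and A = "\<lambda>_. UNIV" and \<Omega> = UNIV])
    show "Int_stable (Collect (closed :: 'a set \<Rightarrow> bool))" by (auto simp: Int_stable_def)
    show "sets \<mu> = sigma_sets UNIV (Collect closed)" "sets \<nu> = sigma_sets UNIV (Collect closed)"
      using sets by (simp_all add: borel_eq_closed)
  qed (use closed_eq \<mu>.emeasure_finite in auto)
qed


text \<open>
  A countable family whose linear span is uniformly dense in the continuous functions. Density of the
  span makes the integrals \<open>\<integral>\<phi> i d\<mu>\<close> determine the weak* topology; it is asked of the span and not of
  the family so that all \<open>\<phi> i\<close> can be bounded by \<open>1\<close>.
\<close>

locale weak_coordinates =
  fixes \<phi> :: "nat \<Rightarrow> 'a::metric_space \<Rightarrow> real"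
  assumes compact_space: "compact (UNIV :: 'a set)"
    and \<phi>_cont: "continuous_on UNIV (\<phi> i)"
    and \<phi>_bound: "\<bar>\<phi> i x\<bar> \<le> 1"
    and \<phi>_span: "continuous_on UNIV f \<Longrightarrow> e > 0 \<Longrightarrow>
      \<exists>I a. finite I \<and> (\<forall>x. \<bar>f x - (\<Sum>i\<in>I. a i * \<phi> i x)\<bar> \<le> e)"
begin

definition coords :: "'a measure \<Rightarrow> nat \<Rightarrow> real" where
  "coords \<mu> i = integral\<^sup>L \<mu> (\<phi> i)"

definition averages :: "('a \<Rightarrow> 'a) \<Rightarrow> 'a \<Rightarrow> nat \<Rightarrow> nat \<Rightarrow> real" where
  "averages T z n i = (\<Sum>j<n. \<phi> i ((T ^^ j) z)) / real n"

lemma integrable_continuous: "continuous_on UNIV f \<Longrightarrow> \<mu> \<in> borel_prob \<Longrightarrow> integrable \<mu> (f :: 'a \<Rightarrow> real)"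
  using integrable_continuous_compact[OF compact_space] .

lemma coords_empirical: "n > 0 \<Longrightarrow> coords (empirical T z n) = averages T z n"
  by (simp add: coords_def averages_def fun_eq_iff integral_empirical
      borel_measurable_continuous_onI[OF \<phi>_cont])

lemma integral_span_approx:
  assumes "continuous_on UNIV f" "e > 0"
  obtains I a where "finite I"
    "\<And>\<mu>. \<mu> \<in> borel_prob \<Longrightarrow> \<bar>integral\<^sup>L \<mu> f - (\<Sum>i\<in>I. a i * coords \<mu> i)\<bar> \<le> e"
proof -
  obtain I a where I: "finite I" "\<And>x. \<bar>f x - (\<Sum>i\<in>I. a i * \<phi> i x)\<bar> \<le> e"
    using \<phi>_span[OF assms] by blast
  show ?thesis
  proof (rule that[OF I(1)])
    fix \<mu> :: "'a measure" assume \<mu>: "\<mu> \<in> borel_prob"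
    then interpret prob_space \<mu> by (simp add: borel_prob_def)
    have int: "integrable \<mu> (\<lambda>x. a i * \<phi> i x)" for i
      using integrable_continuous[OF \<phi>_cont \<mu>] by simp
    have "(\<Sum>i\<in>I. a i * coords \<mu> i) = (\<integral>x. (\<Sum>i\<in>I. a i * \<phi> i x) \<partial>\<mu>)"
      using int by (simp add: coords_def)
    then show "\<bar>integral\<^sup>L \<mu> f - (\<Sum>i\<in>I. a i * coords \<mu> i)\<bar> \<le> e"
      using abs_integral_diff_le[OF integrable_continuous[OF assms(1) \<mu>] _ I(2)] int by simp
  qed
qed

lemma coords_inj:
  assumes "\<mu> \<in> borel_prob" "\<nu> \<in> borel_prob" "coords \<mu> = coords \<nu>"
  shows "\<mu> = \<nu>"
proof (rule borel_prob_eqI[OF assms(1,2)])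
  fix f :: "'a \<Rightarrow> real" assume f: "continuous_on UNIV f"
  have "\<bar>integral\<^sup>L \<mu> f - integral\<^sup>L \<nu> f\<bar> \<le> 0 + e" if "e > 0" for e
  proof -
    obtain I a where I: "\<And>\<mu>. \<mu> \<in> borel_prob \<Longrightarrow> \<bar>integral\<^sup>L \<mu> f - (\<Sum>i\<in>I. a i * coords \<mu> i)\<bar> \<le> e / 2"
      using integral_span_approx[OF f half_gt_zero[OF \<open>e > 0\<close>]] by blast
    show ?thesis using I[OF assms(1)] I[OF assms(2)] unfolding assms(3) by linarith
  qed
  then show "integral\<^sup>L \<mu> f = integral\<^sup>L \<nu> f"
    using field_le_epsilon[of "\<bar>integral\<^sup>L \<mu> f - integral\<^sup>L \<nu> f\<bar>" 0] by simp
qed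

lemma continuous_map_integral:
  assumes "continuous_on UNIV f"
  shows "continuous_map weak_star euclideanreal (\<lambda>\<mu>. integral\<^sup>L \<mu> (f :: 'a \<Rightarrow> real))"
  unfolding continuous_map_def
proof (intro conjI allI impI)
  fix V :: "real set" assume "openin euclideanreal V"
  then have "open V" by simp
  then have "openin weak_star {\<mu> \<in> borel_prob. integral\<^sup>L \<mu> f \<in> V}"
    unfolding weak_star_def using assms
    by (intro topology_generated_by_Basis) blast
  then show "openin weak_star {\<mu> \<in> topspace weak_star. integral\<^sup>L \<mu> f \<in> V}"
    by (simp add: topspace_weak_star)
qed simp

lemma continuous_map_coords: "continuous_map weak_star euclidean coords"
proof -
  have "continuous_map weak_star (product_topology (\<lambda>i. euclidean) UNIV) coords"
    unfolding continuous_map_componentwise_UNIV coords_def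
    using continuous_map_integral[OF \<phi>_cont] by simp
  then show ?thesis by (simp add: euclidean_product_topology)
qed

text \<open>
  Together with the continuity and injectivity of \<open>coords\<close> this says that \<open>coords\<close> is a topological embedding. On a
  subbasic set the reason is that \<open>\<integral>f d\<mu>\<close> is, up to an error, a finite linear combination of coordinates.
\<close>

lemma weak_star_nbhd:
  assumes "openin weak_star U" "\<mu> \<in> U"
  shows "\<exists>\<delta>>0. \<forall>\<nu>\<in>borel_prob. dist (coords \<nu>) (coords \<mu>) < \<delta> \<longrightarrow> \<nu> \<in> U"
proof -
  have "generate_topology_on
     {{\<mu> \<in> borel_prob. integral\<^sup>L \<mu> f \<in> V} | (f :: 'a \<Rightarrow> real) V. continuous_on UNIV f \<and> open V} U"
    using assms(1) unfolding weak_star_def openin_topology_generated_by_iff .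
  then show ?thesis using assms(2)
  proof (induction arbitrary: \<mu>)
    case (Int a b)
    then obtain d e where "d > 0" "e > 0"
      "\<forall>\<nu>\<in>borel_prob. dist (coords \<nu>) (coords \<mu>) < d \<longrightarrow> \<nu> \<in> a"
      "\<forall>\<nu>\<in>borel_prob. dist (coords \<nu>) (coords \<mu>) < e \<longrightarrow> \<nu> \<in> b"
      by (metis IntE)
    then show ?case by (intro exI[of _ "min d e"]) auto
  next
    case (UN K)
    then obtain k where k: "k \<in> K" "\<mu> \<in> k" by blast
    from UN.IH[OF this] show ?case using k by blast
  next
    case (Basis s)
    then obtain f :: "'a \<Rightarrow> real" and V where
      s: "s = {\<mu> \<in> borel_prob. integral\<^sup>L \<mu> f \<in> V}" and f: "continuous_on UNIV f" and "open V" by auto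
    have \<mu>: "\<mu> \<in> borel_prob" "integral\<^sup>L \<mu> f \<in> V" using Basis.prems s by auto
    obtain e where e: "e > 0" "\<And>y. dist y (integral\<^sup>L \<mu> f) < e \<Longrightarrow> y \<in> V"
      using \<open>open V\<close> \<mu>(2) unfolding open_dist by blast
    obtain I a where I: "finite I"
      "\<And>\<mu>. \<mu> \<in> borel_prob \<Longrightarrow> \<bar>integral\<^sup>L \<mu> f - (\<Sum>i\<in>I. a i * coords \<mu> i)\<bar> \<le> e / 3"
      using integral_span_approx[OF f, of "e / 3"] e(1) by auto
    let ?h = "\<lambda>x :: nat \<Rightarrow> real. \<Sum>i\<in>I. a i * x i"
    have "continuous_on UNIV ?h"
      by (intro continuous_intros continuous_on_product_coordinates)
    then obtain d where d: "d > 0" "\<And>x. dist x (coords \<mu>) < d \<Longrightarrow> dist (?h x) (?h (coords \<mu>)) < e / 3"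
      using e(1) unfolding continuous_on_iff by (metis UNIV_I divide_pos_pos zero_less_numeral)
    have "\<nu> \<in> s" if \<nu>: "\<nu> \<in> borel_prob" "dist (coords \<nu>) (coords \<mu>) < d" for \<nu>
    proof -
      have "dist (integral\<^sup>L \<nu> f) (integral\<^sup>L \<mu> f) < e"
        using I(2)[OF \<nu>(1)] I(2)[OF \<mu>(1)] d(2)[OF \<nu>(2)] unfolding dist_real_def by linarith
      then show ?thesis using e(2) \<nu>(1) by (simp add: s)
    qed
    then show ?case using d(1) by blast
  qed simp
qed

text \<open>
  Accumulation of measures becomes accumulation of the orbit averages in a metric space. The zero measure
  at \<open>n = 0\<close> is a single term, while the statement concerns infinitely many.
\<close>

lemma acc_measures_iff:
  "\<mu> \<in> acc_measures T z \<longleftrightarrow>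
     \<mu> \<in> borel_prob \<and> (\<forall>\<delta>>0. \<exists>\<^sub>\<infinity>n. dist (averages T z n) (coords \<mu>) < \<delta>)"
proof (intro iffI conjI allI impI)
  assume \<mu>: "\<mu> \<in> acc_measures T z"
  then show "\<mu> \<in> borel_prob" by (simp add: acc_measures_def)
  fix \<delta> :: real assume "\<delta> > 0"
  let ?U = "{\<nu> \<in> topspace weak_star. coords \<nu> \<in> ball (coords \<mu>) \<delta>}"
  have "openin weak_star ?U"
    by (rule openin_continuous_map_preimage[OF continuous_map_coords]) simp
  moreover have "\<mu> \<in> ?U" using \<open>\<delta> > 0\<close> \<open>\<mu> \<in> borel_prob\<close> by (simp add: topspace_weak_star)
  ultimately have "\<exists>\<^sub>\<infinity>n. empirical T z n \<in> ?U" using \<mu> unfolding acc_measures_def by blast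
  then have "\<exists>\<^sub>\<infinity>n. empirical T z n \<in> ?U \<and> n > 0"
    by (simp add: INFM_nat) (metis gr_implies_not0 less_trans neq0_conv)
  then show "\<exists>\<^sub>\<infinity>n. dist (averages T z n) (coords \<mu>) < \<delta>"
    by (rule INFM_mono) (auto simp: coords_empirical dist_commute)
next
  assume r: "\<mu> \<in> borel_prob \<and> (\<forall>\<delta>>0. \<exists>\<^sub>\<infinity>n. dist (averages T z n) (coords \<mu>) < \<delta>)"
  have "\<exists>\<^sub>\<infinity>n. empirical T z n \<in> U" if U: "openin weak_star U" "\<mu> \<in> U" for U
  proof -
    obtain \<delta> where \<delta>: "\<delta> > 0" "\<And>\<nu>. \<nu> \<in> borel_prob \<Longrightarrow> dist (coords \<nu>) (coords \<mu>) < \<delta> \<Longrightarrow> \<nu> \<in> U"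
      using weak_star_nbhd[OF U] by blast
    have "\<exists>\<^sub>\<infinity>n. dist (averages T z n) (coords \<mu>) < \<delta>" using r \<delta>(1) by blast
    then have "\<exists>\<^sub>\<infinity>n. dist (averages T z n) (coords \<mu>) < \<delta> \<and> n > 0"
      by (simp add: INFM_nat) (metis gr_implies_not0 less_trans neq0_conv)
    then show ?thesis
      by (rule INFM_mono) (auto intro!: \<delta>(2) simp: coords_empirical empirical_borel_prob)
  qed
  then show "\<mu> \<in> acc_measures T z" using r by (simp add: acc_measures_def)
qed

lemma acc_measures_cong:
  assumes "(\<lambda>n. dist (averages T z n) (averages T w n)) \<longlonglongrightarrow> 0"
  shows "acc_measures T z = acc_measures T w"
proof -
  have "\<mu> \<in> acc_measures T w" if lim: "(\<lambda>n. dist (averages T z n) (averages T w n)) \<longlonglongrightarrow> 0"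
    and \<mu>: "\<mu> \<in> acc_measures T z" for \<mu> z w
    unfolding acc_measures_iff
  proof (intro conjI allI impI)
    show "\<mu> \<in> borel_prob" using \<mu> by (simp add: acc_measures_iff)
    fix \<delta> :: real assume \<delta>: "\<delta> > 0"
    have "\<exists>\<^sub>\<infinity>n. dist (averages T z n) (coords \<mu>) < \<delta> / 2"
      using \<mu> half_gt_zero[OF \<delta>] unfolding acc_measures_iff by blast
    moreover have "\<forall>\<^sub>\<infinity>n. dist (averages T z n) (averages T w n) < \<delta> / 2"
      unfolding cofinite_eq_sequentially using lim \<delta> by (auto intro!: order_tendstoD)
    ultimately have "\<exists>\<^sub>\<infinity>n. dist (averages T z n) (coords \<mu>) < \<delta> / 2 \<and>
        dist (averages T z n) (averages T w n) < \<delta> / 2"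
      by (rule INFM_conjI)
    then show "\<exists>\<^sub>\<infinity>n. dist (averages T w n) (coords \<mu>) < \<delta>"
      by (rule INFM_mono) (metis dist_commute dist_triangle_half_r)
  qed
  from this[OF assms] this[of w z] show ?thesis using assms by (auto simp: dist_commute)
qed

text \<open>Averages of length \<open>n\<close> along the two orbits differ in at most \<open>2 * M\<close> terms.\<close>

lemma acc_measures_shift: "acc_measures T ((T ^^ M) z) = acc_measures T (z :: 'a)"
proof (rule acc_measures_cong, rule dist_fun_tendsto_0)
  fix i
  have bd: "\<bar>averages T ((T ^^ M) z) n i - averages T z n i\<bar> \<le> 2 * real M / real n" for n
  proof -
    let ?f = "\<lambda>j. \<phi> i ((T ^^ j) z)"
    have "(\<Sum>j<n. ?f (j + M)) + (\<Sum>j<M. ?f j) = (\<Sum>j<n + M. ?f j)"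
      using sum.atLeastLessThan_concat[of 0 M "n + M" ?f] sum.shift_bounds_nat_ivl[of ?f 0 M n]
      by (simp add: lessThan_atLeast0)
    moreover have "(\<Sum>j<n + M. ?f j) = (\<Sum>j<n. ?f j) + (\<Sum>j<M. ?f (n + j))"
      by (induction M) auto
    moreover have "\<bar>\<Sum>j<M. ?f j\<bar> \<le> (\<Sum>j<M. 1)" "\<bar>\<Sum>j<M. ?f (n + j)\<bar> \<le> (\<Sum>j<M. 1)"
      by (rule order.trans[OF sum_abs sum_mono], rule \<phi>_bound)+
    ultimately have "\<bar>(\<Sum>j<n. ?f (j + M)) - (\<Sum>j<n. ?f j)\<bar> \<le> 2 * real M" by simp
    then show ?thesis
      by (simp add: averages_def funpow_add flip: diff_divide_distrib add.commute)
         (simp add: divide_right_mono)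
  qed
  have "(\<lambda>n. 2 * real M / real n) \<longlonglongrightarrow> 0" by (rule lim_const_over_n)
  then show "(\<lambda>n. \<bar>averages T ((T ^^ M) z) n i - averages T z n i\<bar>) \<longlonglongrightarrow> 0"
    by (rule Lim_null_comparison[rotated]) (use bd in auto)
qed

end

text \<open>
  Take the partitions of unity \<open>h n\<close> subordinate to the balls of radius \<open>1 / (n + 1)\<close> around finite
  nets: by uniform continuity \<open>f\<close> is close to \<open>\<Sum>p. f p * h n p\<close> for large \<open>n\<close>.
\<close>

lemma weak_coordinates_exist:
  assumes compact: "compact (UNIV :: 'a::metric_space set)"
  shows "\<exists>\<phi> :: nat \<Rightarrow> 'a \<Rightarrow> real. weak_coordinates \<phi>"
proof -
  have "\<exists>A :: 'a set. finite A \<and> (\<forall>x. \<exists>p\<in>A. dist x p < 1 / real (Suc n))" for n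
    by (rule compact_finite_net[OF compact, of "1 / real (Suc n)"]) auto
  then obtain A :: "nat \<Rightarrow> 'a set" where A: "\<And>n. finite (A n)"
    "\<And>n x. \<exists>p\<in>A n. dist x p < 1 / real (Suc n)"
    by metis
  define \<psi> where "\<psi> n p x = max 0 (1 / real (Suc n) - dist x p)" for n and p x :: 'a
  define S where "S n x = (\<Sum>p\<in>A n. \<psi> n p x)" for n x
  define h where "h n p x = \<psi> n p x / S n x" for n p x
  have \<psi>0: "\<psi> n p x \<ge> 0" for n p x by (simp add: \<psi>_def)
  have S: "S n x > 0" for n x
  proof -
    obtain p where "p \<in> A n" "dist x p < 1 / real (Suc n)" using A(2) by blast
    then show ?thesis unfolding S_def using A(1) \<psi>0 by (intro sum_pos2[of _ p]) (auto simp: \<psi>_def)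
  qed
  have h_cont: "continuous_on UNIV (h n p)" for n p
    using S unfolding h_def S_def \<psi>_def
    by (intro continuous_intros) (auto simp: less_le)
  have h_le: "0 \<le> h n p x" "h n p x \<le> 1" if "p \<in> A n" for n p x
    using that S[of n x] \<psi>0 A(1) member_le_sum[of p "A n" "\<lambda>p. \<psi> n p x"]
    by (auto simp: h_def S_def)
  have h_sum: "(\<Sum>p\<in>A n. h n p x) = 1" for n x
    using S[of n x] unfolding h_def by (simp add: sum_divide_distrib[symmetric] S_def)
  have h_close: "dist x p < 1 / real (Suc n)" if "h n p x \<noteq> 0" for n p x
    using that by (auto simp: h_def \<psi>_def max_def split: if_splits)
  define H where "H = (\<Union>n. h n ` A n)"
  have "countable H" unfolding H_def using A(1) by (simp add: countable_finite)
  moreover have "H \<noteq> {}" using A(2)[where n = 0] by (fastforce simp: H_def)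
  ultimately have range: "range (from_nat_into H) = H" by (simp add: range_from_nat_into)
  define \<phi> where "\<phi> = from_nat_into H"
  have \<phi>H: "\<phi> i \<in> H" for i using range by (auto simp: \<phi>_def)
  have "weak_coordinates \<phi>"
  proof
    show "compact (UNIV :: 'a set)" by fact
    show "continuous_on UNIV (\<phi> i)" for i using \<phi>H[of i] h_cont by (auto simp: H_def)
    show "\<bar>\<phi> i x\<bar> \<le> 1" for i x
    proof -
      obtain n p where "p \<in> A n" "\<phi> i = h n p" using \<phi>H[of i] by (auto simp: H_def)
      then show ?thesis using h_le by simp
    qed
    fix f :: "'a \<Rightarrow> real" and e :: real assume f: "continuous_on UNIV f" and e: "e > 0"
    have "uniformly_continuous_on UNIV f" by (rule compact_uniformly_continuous[OF f compact])
    then obtain d where d: "d > 0" "\<And>x y. dist x y < d \<Longrightarrow> dist (f x) (f y) < e"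
      unfolding uniformly_continuous_on_def using e by (metis UNIV_I)
    obtain n where n: "1 / real (Suc n) < d" using d(1) nat_approx_posE by blast
    have "\<exists>i. \<phi> i = k" if "k \<in> H" for k using that range unfolding \<phi>_def by (metis imageE)
    then obtain i where i: "\<And>k. k \<in> H \<Longrightarrow> \<phi> (i k) = k" by metis
    define B where "B = h n ` A n"
    have B: "finite B" "B \<subseteq> H" using A(1) by (auto simp: B_def H_def)
    have inj_i: "inj_on i B" by (metis B(2) i inj_onI subsetD)
    \<comment> \<open>different points of the net may yield the same function \<open>k\<close>\<close>
  define r where "r k = (\<Sum>p\<in>{p\<in>A n. h n p = k}. f p)" for k
    show "\<exists>I a. finite I \<and> (\<forall>x. \<bar>f x - (\<Sum>i\<in>I. a i * \<phi> i x)\<bar> \<le> e)"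
    proof (intro exI conjI allI)
      show "finite (i ` B)" using B by simp
      fix x
      have "(\<Sum>j\<in>i ` B. (r \<circ> \<phi>) j * \<phi> j x) = (\<Sum>k\<in>B. r k * k x)"
        using inj_i B i by (subst sum.reindex) (auto intro!: sum.cong)
      also have "\<dots> = (\<Sum>k\<in>B. \<Sum>p\<in>{p\<in>A n. h n p = k}. f p * h n p x)"
        unfolding r_def sum_distrib_right by (intro sum.cong refl) auto
      also have "\<dots> = (\<Sum>p\<in>A n. f p * h n p x)"
        unfolding B_def using A(1) by (rule sum.image_gen[symmetric])
      finally have eq: "(\<Sum>j\<in>i ` B. (r \<circ> \<phi>) j * \<phi> j x) = (\<Sum>p\<in>A n. f p * h n p x)" .
      have "f x - (\<Sum>p\<in>A n. f p * h n p x) = (\<Sum>p\<in>A n. (f x - f p) * h n p x)"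
        using h_sum[of n x] by (simp add: left_diff_distrib sum_subtractf flip: sum_distrib_left)
      also have "\<bar>\<dots>\<bar> \<le> (\<Sum>p\<in>A n. e * h n p x)"
      proof (rule order.trans[OF sum_abs sum_mono])
        fix p assume p: "p \<in> A n"
        show "\<bar>(f x - f p) * h n p x\<bar> \<le> e * h n p x"
        proof (cases "h n p x = 0")
          case False
          then have "\<bar>f x - f p\<bar> \<le> e"
            using d(2)[of x p] h_close[of n p x] n by (simp add: dist_real_def)
          then show ?thesis using h_le(1)[OF p] by (simp add: abs_mult mult_right_mono)
        qed simp
      qed
      also have "\<dots> = e" using h_sum by (simp flip: sum_distrib_left)
      finally show "\<bar>f x - (\<Sum>j\<in>i ` B. (r \<circ> \<phi>) j * \<phi> j x)\<bar> \<le> e" by (simp only: eq)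
    qed
  qed
  then show ?thesis by blast
qed

section \<open>Birkhoff sums and balanced samples\<close>

lemma (in prob_space) exists_le_zero_of_integral_zero:
  fixes f :: "'a \<Rightarrow> real"
  assumes "integrable M f" "integral\<^sup>L M f = 0"
  shows "\<exists>y\<in>space M. f y \<le> 0"
proof (rule ccontr)
  assume "\<not> ?thesis"
  then have pos: "\<And>y. y \<in> space M \<Longrightarrow> f y > 0" by force
  then have "AE y in M. f y = 0"
    using assms by (subst integral_nonneg_eq_0_iff_AE[symmetric]) (auto intro!: AE_I2 less_imp_le)
  then have "AE y in M. False" by (rule AE_mp) (use pos in \<open>force intro!: AE_I2\<close>)
  then show False by simp
qed

text \<open>
  Regard \<open>h\<close> as a random vector of mean \<open>0\<close> with index set \<open>F\<close>. If \<open>S\<close> is the sum over the points chosen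
  so far, the mean of the inner product with \<open>S\<close> vanishes, so the next point can be chosen with
  \<open>\<langle>S, h y\<rangle> \<le> 0\<close>. Then the squared norm of the sum grows by at most \<open>D\<close> in each step, and the sum
  of \<open>j\<close> terms has norm at most \<open>sqrt (j * D)\<close>, which is at most \<open>\<eta> * j\<close> for large \<open>j\<close>.
\<close>

lemma (in prob_space) balanced_sample:
  fixes h :: "'i \<Rightarrow> 'a \<Rightarrow> real" and H \<eta> :: real
  assumes F: "finite F" and int: "\<And>f. f \<in> F \<Longrightarrow> integrable M (h f)"
    and zero: "\<And>f. f \<in> F \<Longrightarrow> integral\<^sup>L M (h f) = 0"
    and bound: "\<And>f y. f \<in> F \<Longrightarrow> \<bar>h f y\<bar> \<le> H" and "\<eta> > 0"
  shows "\<exists>ys. ys \<noteq> [] \<and> hd ys = v \<and> (\<forall>f\<in>F. \<bar>\<Sum>y\<leftarrow>ys. h f y\<bar> \<le> \<eta> * length ys)"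
proof -
  define D where "D = card F * H\<^sup>2"
  have sq: "(\<Sum>f\<in>F. (h f y)\<^sup>2) \<le> D" for y
    unfolding D_def using bound by (intro sum_bounded_above) (metis abs_ge_zero power2_abs power_mono)
  have greedy: "\<exists>ys. length ys = Suc j \<and> hd ys = v \<and>
      (\<Sum>f\<in>F. (\<Sum>y\<leftarrow>ys. h f y)\<^sup>2) \<le> Suc j * D" for j
  proof (induction j)
    case 0
    show ?case using sq[of v] by (intro exI[of _ "[v]"]) simp
  next
    case (Suc j)
    then obtain ys where ys: "length ys = Suc j" "hd ys = v"
      "(\<Sum>f\<in>F. (\<Sum>y\<leftarrow>ys. h f y)\<^sup>2) \<le> Suc j * D" by blast
    define S where "S f = (\<Sum>y\<leftarrow>ys. h f y)" for f
    obtain y where y: "(\<Sum>f\<in>F. S f * h f y) \<le> 0"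
      using exists_le_zero_of_integral_zero[of "\<lambda>y. \<Sum>f\<in>F. S f * h f y"] int zero by auto
    have "(\<Sum>f\<in>F. (\<Sum>y\<leftarrow>ys @ [y]. h f y)\<^sup>2) = (\<Sum>f\<in>F. (S f + h f y)\<^sup>2)"
      by (simp add: S_def)
    also have "\<dots> = (\<Sum>f\<in>F. (S f)\<^sup>2) + 2 * (\<Sum>f\<in>F. S f * h f y) + (\<Sum>f\<in>F. (h f y)\<^sup>2)"
      by (simp add: power2_sum sum.distrib sum_distrib_left algebra_simps)
    also have "\<dots> \<le> Suc j * D + 0 + D"
      using ys(3) y sq[of y] unfolding S_def by linarith
    finally have "(\<Sum>f\<in>F. (\<Sum>y\<leftarrow>ys @ [y]. h f y)\<^sup>2) \<le> Suc (Suc j) * D"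
      by (simp add: algebra_simps)
    then show ?case using ys(1,2) by (intro exI[of _ "ys @ [y]"]) (auto simp: hd_append)
  qed
  obtain j where j: "D / \<eta>\<^sup>2 \<le> real (Suc j)"
    using real_arch_simple[of "D / \<eta>\<^sup>2"] by (metis le_SucI of_nat_le_iff order.refl order.trans)
  obtain ys where ys: "length ys = Suc j" "hd ys = v"
    "(\<Sum>f\<in>F. (\<Sum>y\<leftarrow>ys. h f y)\<^sup>2) \<le> Suc j * D" using greedy by blast
  have "\<bar>\<Sum>y\<leftarrow>ys. h f y\<bar> \<le> \<eta> * length ys" if f: "f \<in> F" for f
  proof (rule power2_le_imp_le)
    have "\<bar>\<Sum>y\<leftarrow>ys. h f y\<bar>\<^sup>2 \<le> (\<Sum>f\<in>F. (\<Sum>y\<leftarrow>ys. h f y)\<^sup>2)"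
      using member_le_sum[OF f _ F, of "\<lambda>f. (\<Sum>y\<leftarrow>ys. h f y)\<^sup>2"] by simp
    also have "\<dots> \<le> Suc j * D" by (rule ys(3))
    also have "\<dots> \<le> Suc j * (\<eta>\<^sup>2 * Suc j)"
      using j \<open>\<eta> > 0\<close> by (intro mult_left_mono) (simp_all add: divide_le_eq mult.commute)
    finally show "\<bar>\<Sum>y\<leftarrow>ys. h f y\<bar>\<^sup>2 \<le> (\<eta> * length ys)\<^sup>2"
      by (simp add: ys(1) power_mult_distrib power2_eq_square mult_ac)
  qed (use \<open>\<eta> > 0\<close> in simp)
  then show ?thesis using ys(1,2) by (intro exI[of _ ys]) auto
qed

definition birkhoff :: "('a \<Rightarrow> 'a) \<Rightarrow> nat \<Rightarrow> ('a \<Rightarrow> real) \<Rightarrow> 'a \<Rightarrow> real" where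
  "birkhoff T n f x = (\<Sum>j<n. f ((T ^^ j) x))"

lemma funpow_funpow: "(T ^^ m) ((T ^^ n) x) = (T ^^ (n + m)) x"
  by (metis add.commute comp_apply funpow_add)

lemma birkhoff_add: "birkhoff T (m + n) f x = birkhoff T m f x + birkhoff T n f ((T ^^ m) x)"
  unfolding birkhoff_def by (induction n) (simp_all add: funpow_funpow)

lemma birkhoff_bound:
  assumes "\<And>y. \<bar>f y\<bar> \<le> B"
  shows "\<bar>birkhoff T n f x\<bar> \<le> n * B"
  unfolding birkhoff_def using sum_norm_bound[of "{..<n}" "\<lambda>j. f ((T ^^ j) x)" B] assms by simp

lemma invariant_funpow:
  assumes \<mu>: "\<mu> \<in> invariant_measures T" and T: "T \<in> measurable borel borel"
  shows "distr \<mu> borel (T ^^ j) = \<mu>" "T ^^ j \<in> measurable borel borel"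
proof -
  have sets: "sets \<mu> = sets borel" using \<mu> by (simp add: invariant_measures_def borel_prob_def)
  show meas: "T ^^ j \<in> measurable borel borel" for j
    by (induction j) (use T in \<open>auto intro: measurable_comp\<close>)
  show "distr \<mu> borel (T ^^ j) = \<mu>"
  proof (induction j)
    case 0
    show ?case using sets by (simp add: distr_id2 id_def)
  next
    case (Suc j)
    have "distr \<mu> borel (T ^^ Suc j) = distr (distr \<mu> borel (T ^^ j)) borel T"
      using meas[of j] T sets by (subst distr_distr) (simp_all cong: measurable_cong_sets)
    then show ?case using Suc \<mu> by (simp add: invariant_measures_def comp_def)
  qed
qed

lemma integral_birkhoff:
  assumes \<mu>: "\<mu> \<in> invariant_measures T" and T: "T \<in> measurable borel borel"
    and f: "integrable \<mu> f"
  shows "integrable \<mu> (birkhoff T n f)" "integral\<^sup>L \<mu> (birkhoff T n f) = n * integral\<^sup>L \<mu> f"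
proof -
  have sets: "sets \<mu> = sets borel" using \<mu> by (simp add: invariant_measures_def borel_prob_def)
  have m: "T ^^ j \<in> measurable \<mu> borel" for j
    using invariant_funpow(2)[OF \<mu> T] sets by (simp cong: measurable_cong_sets)
  have fb: "f \<in> borel_measurable borel"
    using borel_measurable_integrable[OF f] sets by (simp cong: measurable_cong_sets)
  have int: "integrable \<mu> (\<lambda>x. f ((T ^^ j) x))" for j
    using integrable_distr[OF m, of j f] f invariant_funpow(1)[OF \<mu> T] by simp
  have eq: "(\<integral>x. f ((T ^^ j) x) \<partial>\<mu>) = integral\<^sup>L \<mu> f" for j
    using integral_distr[OF m fb, of j] invariant_funpow(1)[OF \<mu> T] by simp
  show "integrable \<mu> (birkhoff T n f)" unfolding birkhoff_def using int by simp
  show "integral\<^sup>L \<mu> (birkhoff T n f) = n * integral\<^sup>L \<mu> f"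
    unfolding birkhoff_def using int eq by simp
qed

text \<open>
  The number of visits to \<open>V\<close> is the Birkhoff sum of the indicator, whose mean is \<open>n * \<mu>(V)\<close>; some
  point attains at least the mean.
\<close>

lemma frequent_visits:
  fixes n :: nat
  assumes \<mu>: "\<mu> \<in> invariant_measures T" and T: "T \<in> measurable borel borel"
    and V: "V \<in> sets borel"
  shows "\<exists>y. real (card {j. j < n \<and> (T ^^ j) y \<in> V}) \<ge> n * measure \<mu> V"
proof -
  interpret prob_space \<mu> using \<mu> by (simp add: invariant_measures_def borel_prob_def)
  have sets: "sets \<mu> = sets borel" using \<mu> by (simp add: invariant_measures_def borel_prob_def)
  have sp: "space \<mu> = UNIV" using sets_eq_imp_space_eq[OF sets] by simp
  have int: "integrable \<mu> (indicator V :: 'a \<Rightarrow> real)"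
    using V sets by (intro integrable_const_bound[of _ 1]) (auto simp: indicator_def cong: measurable_cong_sets)
  let ?g = "\<lambda>y. n * measure \<mu> V - birkhoff T n (indicator V) y"
  have "integrable \<mu> ?g" "integral\<^sup>L \<mu> ?g = 0"
    using integral_birkhoff[OF \<mu> T int, of n] V sets sp prob_space by simp_all
  then obtain y where "?g y \<le> 0"
    using exists_le_zero_of_integral_zero[of ?g] by blast
  moreover have "birkhoff T n (indicator V) y = card {j. j < n \<and> (T ^^ j) y \<in> V}"
    by (simp add: birkhoff_def indicator_def sum.If_cases Int_def conj_commute)
  ultimately show ?thesis by (intro exI[of _ y]) simp
qed

section \<open>Shadowing finite and infinite lists of orbit segments\<close>

text \<open>A starting point, a length and the accuracy with which the orbit segment is to be followed.\<close>

type_synonym 'a segment = "'a \<times> nat \<times> real"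

fun total_length :: "'a segment list \<Rightarrow> nat" where
  "total_length [] = 0"
| "total_length ((x, n, \<epsilon>) # ws) = n + total_length ws"

fun shadow :: "('a::metric_space \<Rightarrow> 'a) \<Rightarrow> (nat \<Rightarrow> nat) \<Rightarrow> 'a segment list \<Rightarrow> 'a set" where
  "shadow T g [] = UNIV"
| "shadow T g ((x, n, \<epsilon>) # ws) = blowup_ball T g n x \<epsilon> \<inter> (T ^^ n) -` shadow T g ws"

lemma total_length_append: "total_length (ws @ vs) = total_length ws + total_length vs"
  by (induction ws rule: total_length.induct) auto

lemma shadow_append:
  "shadow T g (ws @ vs) = shadow T g ws \<inter> (T ^^ total_length ws) -` shadow T g vs"
proof (induction ws rule: total_length.induct)
  case (2 x n \<epsilon> ws)
  then show ?case by (auto simp: funpow_funpow)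
qed simp

lemma shadow_replicate:
  assumes "z \<in> shadow T g (concat (replicate r ws))" "u < r"
  shows "(T ^^ (u * total_length ws)) z \<in> shadow T g ws"
  using assms
proof (induction r arbitrary: z u)
  case (Suc r)
  show ?case
  proof (cases u)
    case 0
    then show ?thesis using Suc.prems by (simp add: shadow_append)
  next
    case (Suc u')
    then have "(T ^^ (u' * total_length ws)) ((T ^^ total_length ws) z) \<in> shadow T g ws"
      using Suc.IH[of "(T ^^ total_length ws) z" u'] Suc.prems by (simp add: shadow_append)
    then show ?thesis using Suc by (simp add: funpow_funpow)
  qed
qed simp

lemma total_length_replicate: "total_length (concat (replicate r ws)) = r * total_length ws"
  by (induction r) (simp_all add: total_length_append)

lemma mem_shadow_iff_nth:
  "z \<in> shadow T g ws \<longleftrightarrow> (\<forall>j<length ws. (T ^^ total_length (take j ws)) z \<in>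
     blowup_ball T g (fst (snd (ws ! j))) (fst (ws ! j)) (snd (snd (ws ! j))))"
proof (induction ws rule: rev_induct)
  case (snoc w ws)
  have "(\<forall>j<length (ws @ [w]). P j) \<longleftrightarrow> (\<forall>j<length ws. P j) \<and> P (length ws)" for P
    by (auto simp: less_Suc_eq)
  then show ?case by (cases w) (simp add: snoc shadow_append nth_append)
qed simp

lemma total_length_take:
  "j \<le> length ws \<Longrightarrow> total_length (take j ws) = (\<Sum>i=1..j. fst (snd (ws ! (i - 1))))"
proof (induction j)
  case (Suc j)
  then show ?case
    by (cases "ws ! j") (simp add: take_Suc_conv_app_nth total_length_append)
qed simp

text \<open>
  The almost product property with a fixed blowup function \<open>g\<close> and fixed minimal lengths \<open>m\<close>.
\<close>

locale almost_product =
  fixes T :: "'a::metric_space \<Rightarrow> 'a" and g :: "nat \<Rightarrow> nat" and m :: "real \<Rightarrow> nat"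
  assumes compact_space: "compact (UNIV :: 'a set)"
    and T_cont: "continuous_on UNIV T"
    and g_blowup: "blowup g"
    and shadowing: "\<And>k (x :: nat \<Rightarrow> 'a) \<epsilon> n. k \<ge> 2 \<Longrightarrow> (\<forall>j\<in>{1..k}. \<epsilon> j > 0 \<and> n j \<ge> m (\<epsilon> j)) \<Longrightarrow>
      (\<Inter>j\<in>{1..k}. (T ^^ (\<Sum>i=1..j-1. n i)) -` blowup_ball T g (n j) (x j) (\<epsilon> j)) \<noteq> {}"
begin

definition admissible :: "'a segment list \<Rightarrow> bool" where
  "admissible ws \<longleftrightarrow> (\<forall>(x, n, \<epsilon>)\<in>set ws. \<epsilon> > 0 \<and> n \<ge> m \<epsilon>)"

lemma T_measurable: "T \<in> measurable borel borel"
  using borel_measurable_continuous_onI[OF T_cont] .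

lemma funpow_cont: "continuous_on UNIV (T ^^ j)"
proof (induction j)
  case (Suc j)
  show ?case using continuous_on_compose[OF Suc continuous_on_subset[OF T_cont]] by simp
qed (simp add: id_def)

lemma shadow_nonempty:
  assumes "admissible ws"
  shows "shadow T g ws \<noteq> {}"
proof -
  have long: "shadow T g ws \<noteq> {}" if ws: "admissible ws" "length ws \<ge> 2" for ws
  proof -
    let ?n = "\<lambda>j. fst (snd (ws ! (j - 1)))"
      and ?x = "\<lambda>j. fst (ws ! (j - 1))" and ?\<epsilon> = "\<lambda>j. snd (snd (ws ! (j - 1)))"
    have "?\<epsilon> j > 0 \<and> ?n j \<ge> m (?\<epsilon> j)" if "j \<in> {1..length ws}" for j
    proof -
      have "ws ! (j - 1) \<in> set ws" using that by (intro nth_mem) auto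
      then show ?thesis using ws(1) unfolding admissible_def by (auto simp: case_prod_beta)
    qed
    then obtain z where z: "\<And>j. j \<in> {1..length ws} \<Longrightarrow>
        (T ^^ (\<Sum>i=1..j-1. ?n i)) z \<in> blowup_ball T g (?n j) (?x j) (?\<epsilon> j)"
      using shadowing[of "length ws" ?\<epsilon> ?n ?x] ws(2) by fastforce
    have "z \<in> shadow T g ws"
      unfolding mem_shadow_iff_nth
    proof (intro allI impI)
      fix j assume "j < length ws"
      then show "(T ^^ total_length (take j ws)) z \<in>
          blowup_ball T g (fst (snd (ws ! j))) (fst (ws ! j)) (snd (snd (ws ! j)))"
        using z[of "Suc j"] by (simp add: total_length_take)
    qed
    then show ?thesis by blast
  qed
  consider "ws = []" | w where "ws = [w]" | "length ws \<ge> 2"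
    by (cases ws rule: remdups_adj.cases) auto
  then show ?thesis
  proof cases
    case 2
    \<comment> \<open>the almost product property speaks about at least two segments\<close>
    then have "shadow T g (ws @ ws) \<noteq> {}"
      using assms by (intro long) (auto simp: admissible_def)
    then show ?thesis by (auto simp: shadow_append)
  qed (use long assms in auto)
qed

lemma closed_blowup_ball: "closed (blowup_ball T g n x \<epsilon>)"
proof -
  have "blowup_ball T g n x \<epsilon> = (\<Union>\<Lambda>\<in>{\<Lambda>. \<Lambda> \<subseteq> {..<n} \<and> card ({..<n} - \<Lambda>) \<le> g n}.
      (\<Inter>j\<in>\<Lambda>. {y. dist ((T ^^ j) x) ((T ^^ j) y) \<le> \<epsilon>}))"
    unfolding blowup_ball_def by blast
  also have "closed \<dots>"
    by (intro closed_UN closed_INT ballI closed_Collect_le continuous_intros funpow_cont finite_subset[OF _ finite_Pow_iff[THEN iffD2, OF finite_lessThan[of n]]]) auto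
  finally show ?thesis .
qed

lemma closed_shadow: "closed (shadow T g ws)"
proof (induction ws rule: total_length.induct)
  case (2 x n \<epsilon> ws)
  have "closed ((T ^^ n) -` shadow T g ws)"
    using closed_vimage[OF 2 funpow_cont] .
  then show ?case using closed_blowup_ball by auto
qed simp

text \<open>
  Shadowing sets are closed, so a sequence of finite lists can be shadowed in succession: the sets of
  points that shadow the first \<open>k\<close> lists are nested nonempty compact sets.
\<close>

lemma infinite_shadowing:
  assumes "\<And>k. admissible (W k)"
  shows "\<exists>z. \<forall>k. (T ^^ total_length (concat (map W [0..<k]))) z \<in> shadow T g (W k)"
proof -
  let ?P = "\<lambda>k. concat (map W [0..<k])"
  have sub: "shadow T g (?P l) \<subseteq> shadow T g (?P k)" if "k \<le> l" for k l
    using that by (induction rule: dec_induct) (auto simp: shadow_append)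
  have "UNIV \<inter> (\<Inter>k. shadow T g (?P k)) \<noteq> {}"
  proof (rule compact_imp_fip_image[OF compact_space])
    show "closed (shadow T g (?P k))" for k by (rule closed_shadow)
    fix I :: "nat set" assume I: "finite I" "I \<subseteq> UNIV"
    have "admissible (?P (Max (insert 0 I)))" using assms by (fastforce simp: admissible_def)
    then have "shadow T g (?P (Max (insert 0 I))) \<noteq> {}" by (rule shadow_nonempty)
    moreover have "shadow T g (?P (Max (insert 0 I))) \<subseteq> (\<Inter>k\<in>I. shadow T g (?P k))"
      using I(1) by (intro INT_greatest sub Max_ge) auto
    ultimately show "UNIV \<inter> (\<Inter>k\<in>I. shadow T g (?P k)) \<noteq> {}" by blast
  qed
  then obtain z where z: "\<And>k. z \<in> shadow T g (?P k)" by blast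
  have "(T ^^ total_length (?P k)) z \<in> shadow T g (W k)" for k
    using z[of "Suc k"] by (simp add: shadow_append)
  then show ?thesis by blast
qed

end

section \<open>Blocks of segments that represent an invariant measure\<close>

lemma blowup_ballE:
  assumes "z \<in> blowup_ball T g n x \<epsilon>"
  obtains \<Lambda> where "\<Lambda> \<subseteq> {..<n}" "card ({..<n} - \<Lambda>) \<le> g n"
    "\<And>j. j \<in> \<Lambda> \<Longrightarrow> dist ((T ^^ j) x) ((T ^^ j) z) \<le> \<epsilon>"
proof -
  from assms have "\<exists>\<Lambda>\<subseteq>{..<n}. card ({..<n} - \<Lambda>) \<le> g n \<and>
     (\<forall>j\<in>\<Lambda>. dist ((T ^^ j) x) ((T ^^ j) z) \<le> \<epsilon>)"
    unfolding blowup_ball_def mem_Collect_eq .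
  then obtain \<Lambda> where \<Lambda>: "\<Lambda> \<subseteq> {..<n} \<and> card ({..<n} - \<Lambda>) \<le> g n \<and>
     (\<forall>j\<in>\<Lambda>. dist ((T ^^ j) x) ((T ^^ j) z) \<le> \<epsilon>)" ..
  show thesis by (rule that[of \<Lambda>]) (simp_all add: \<Lambda>)
qed

text \<open>
  Each of the at most \<open>g n\<close> error times contributes at most \<open>2\<close>, every other time at most \<open>\<eta>\<close>.
\<close>

lemma birkhoff_blowup_ball:
  assumes close: "\<And>x y. dist x y \<le> \<epsilon> \<Longrightarrow> \<bar>f x - f y\<bar> \<le> \<eta>" and bound: "\<And>x. \<bar>f x\<bar> \<le> 1" and "\<eta> \<ge> 0"
    and z: "z \<in> blowup_ball T g n x \<epsilon>"
  shows "\<bar>birkhoff T n f z - birkhoff T n f x\<bar> \<le> n * \<eta> + 2 * real (g n)"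
proof -
  obtain \<Lambda> where \<Lambda>: "\<Lambda> \<subseteq> {..<n}" "card ({..<n} - \<Lambda>) \<le> g n"
    "\<And>j. j \<in> \<Lambda> \<Longrightarrow> dist ((T ^^ j) x) ((T ^^ j) z) \<le> \<epsilon>"
    using blowup_ballE[OF z] by metis
  have "\<bar>birkhoff T n f z - birkhoff T n f x\<bar> \<le> (\<Sum>j<n. \<bar>f ((T ^^ j) z) - f ((T ^^ j) x)\<bar>)"
    unfolding birkhoff_def sum_subtractf[symmetric] by (rule sum_abs)
  also have "\<dots> \<le> (\<Sum>j<n. \<eta> + (if j \<in> \<Lambda> then 0 else 2))"
  proof (rule sum_mono)
    fix j
    show "\<bar>f ((T ^^ j) z) - f ((T ^^ j) x)\<bar> \<le> \<eta> + (if j \<in> \<Lambda> then 0 else 2)"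
    proof (cases "j \<in> \<Lambda>")
      case True
      then show ?thesis using close[OF \<Lambda>(3)] by (simp add: abs_minus_commute)
    next
      case False
      then show ?thesis using bound[of "(T ^^ j) z"] bound[of "(T ^^ j) x"] \<open>\<eta> \<ge> 0\<close> by simp
    qed
  qed
  also have "\<dots> = n * \<eta> + 2 * card ({..<n} - \<Lambda>)"
    by (simp add: sum.distrib sum.If_cases Diff_eq)
  finally show ?thesis using \<Lambda>(2) by linarith
qed

lemma uniform_modulus:
  fixes F :: "('a::metric_space \<Rightarrow> real) set"
  assumes "compact (UNIV :: 'a set)" "finite F" "\<And>f. f \<in> F \<Longrightarrow> continuous_on UNIV f" "\<eta> > 0"
  shows "\<exists>d>0. \<forall>f\<in>F. \<forall>x y. dist x y < d \<longrightarrow> \<bar>f x - f y\<bar> \<le> \<eta>"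
  using assms(2,3)
proof (induction F rule: finite_induct)
  case (insert f F)
  then obtain d where d: "d > 0" "\<forall>f\<in>F. \<forall>x y. dist x y < d \<longrightarrow> \<bar>f x - f y\<bar> \<le> \<eta>" by auto
  have "uniformly_continuous_on UNIV f"
    by (rule compact_uniformly_continuous[OF insert.prems[OF insertI1] assms(1)])
  then obtain d' where d': "d' > 0" "\<And>x y. dist x y < d' \<Longrightarrow> dist (f x) (f y) < \<eta>"
    unfolding uniformly_continuous_on_def using assms(4) by (metis UNIV_I)
  show ?case
    using d d' by (intro exI[of _ "min d d'"]) (auto simp: dist_real_def intro: less_imp_le)
qed (auto intro: exI[of _ 1])

context almost_product
begin

lemma g_small: "e > 0 \<Longrightarrow> \<forall>\<^sub>F n in sequentially. real (g n) < e * real n"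
proof -
  assume "e > 0"
  have "(\<lambda>n. real (g n) / real n) \<longlonglongrightarrow> 0" using g_blowup by (simp add: blowup_def)
  then have "\<forall>\<^sub>F n in sequentially. real (g n) / real n < e"
    using \<open>e > 0\<close> by (rule order_tendstoD)
  then show ?thesis using eventually_gt_at_top[of 0]
    by eventually_elim (simp add: divide_less_eq mult.commute)
qed

text \<open>
  Some invariant measure charges a ball \<open>B\<close> inside \<open>V\<close>, and a suitable orbit segment spends a positive
  proportion of its time in \<open>B\<close>. The errors permitted in the blowup ball have proportion tending to
  \<open>0\<close>, hence they cannot cover all these visits.
\<close>

lemma visiting_segment:
  assumes "open V" "V \<inter> measure_center T \<noteq> {}"
  shows "\<exists>\<epsilon>0>0. \<forall>\<epsilon>\<le>\<epsilon>0. \<forall>\<^sub>F n in sequentially.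
    \<exists>y. \<forall>z\<in>blowup_ball T g n y \<epsilon>. \<exists>j<n. (T ^^ j) z \<in> V"
proof -
  have "V \<inter> (\<Union>\<mu>\<in>invariant_measures T. supp \<mu>) \<noteq> {}"
    using assms open_Int_closure_eq_empty unfolding measure_center_def by blast
  then obtain \<mu> p where \<mu>: "\<mu> \<in> invariant_measures T" and p: "p \<in> supp \<mu>" "p \<in> V" by blast
  interpret prob_space \<mu> using \<mu> by (simp add: invariant_measures_def borel_prob_def)
  obtain d where d: "d > 0" "ball p d \<subseteq> V" using assms(1) p(2) openE by blast
  let ?B = "ball p (d / 2)"
  have "emeasure \<mu> ?B > 0" using p(1) d(1) unfolding supp_def by simp
  then have pos: "measure \<mu> ?B > 0" by (simp add: emeasure_eq_measure)
  show ?thesis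
  proof (intro exI[of _ "d / 2 / 2"] conjI allI impI)
    fix \<epsilon> assume \<epsilon>: "\<epsilon> \<le> d / 2 / 2"
    show "\<forall>\<^sub>F n in sequentially. \<exists>y. \<forall>z\<in>blowup_ball T g n y \<epsilon>. \<exists>j<n. (T ^^ j) z \<in> V"
      using g_small[OF pos]
    proof eventually_elim
      case (elim n)
      obtain y where y: "real (card {j. j < n \<and> (T ^^ j) y \<in> ?B}) \<ge> n * measure \<mu> ?B"
        using frequent_visits[OF \<mu> T_measurable, of ?B n] by auto
      have "\<exists>j<n. (T ^^ j) z \<in> V" if z: "z \<in> blowup_ball T g n y \<epsilon>" for z
      proof -
        obtain \<Lambda> where \<Lambda>: "\<Lambda> \<subseteq> {..<n}" "card ({..<n} - \<Lambda>) \<le> g n"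
          "\<And>j. j \<in> \<Lambda> \<Longrightarrow> dist ((T ^^ j) y) ((T ^^ j) z) \<le> \<epsilon>"
          using blowup_ballE[OF z] by metis
        have "\<not> {j. j < n \<and> (T ^^ j) y \<in> ?B} \<subseteq> {..<n} - \<Lambda>"
        proof
          assume "{j. j < n \<and> (T ^^ j) y \<in> ?B} \<subseteq> {..<n} - \<Lambda>"
          then have "card {j. j < n \<and> (T ^^ j) y \<in> ?B} \<le> g n"
            using card_mono[OF finite_Diff[OF finite_lessThan]] \<Lambda>(2) order.trans by blast
          then have "real (card {j. j < n \<and> (T ^^ j) y \<in> ?B}) \<le> real (g n)" by simp
          then show False using y elim by (simp add: mult.commute)
        qed
        then obtain j where j: "j < n" "(T ^^ j) y \<in> ?B" "j \<in> \<Lambda>" by auto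
        then have "dist p ((T ^^ j) z) < d"
          using dist_triangle[of p "(T ^^ j) z" "(T ^^ j) y"] \<Lambda>(3)[OF j(3)] \<epsilon> d(1) by simp
        then show ?thesis using j(1) d(2) by auto
      qed
      then show ?case by blast
    qed
  qed (use d in simp)
qed

lemma birkhoff_shadow_map:
  fixes D :: real
  assumes close: "\<And>y z. z \<in> blowup_ball T g n y \<epsilon> \<Longrightarrow> \<bar>birkhoff T n f z - birkhoff T n f y\<bar> \<le> D"
    and z: "z \<in> shadow T g (map (\<lambda>y. (y, n, \<epsilon>)) ys)"
  shows "\<bar>birkhoff T (length ys * n) f z - (\<Sum>y\<leftarrow>ys. birkhoff T n f y)\<bar> \<le> length ys * D"
  using z
proof (induction ys arbitrary: z)
  case (Cons y ys)
  have "\<bar>birkhoff T n f z - birkhoff T n f y\<bar> \<le> D" using Cons.prems close by simp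
  moreover have "\<bar>birkhoff T (length ys * n) f ((T ^^ n) z) - (\<Sum>y\<leftarrow>ys. birkhoff T n f y)\<bar> \<le> length ys * D"
    using Cons by simp
  ultimately show ?case by (simp add: birkhoff_add algebra_simps)
qed (simp add: birkhoff_def)

lemma total_length_map: "total_length (map (\<lambda>y. (y, n, \<epsilon>)) ys) = length ys * n"
  by (induction ys) auto

text \<open>
  The error \<open>\<eta>\<close> is the sum of three parts: the variation of \<open>f\<close> at distance \<open>\<epsilon>\<close>, the error times of
  the blowup balls, and the imbalance of the sample. The prescribed first sample point is the start of
  a segment visiting \<open>V\<close>.
\<close>

lemma block_exists:
  fixes \<eta> :: real
  assumes \<alpha>: "\<alpha> \<in> invariant_measures T" and F: "finite F"
    and cont: "\<And>f. f \<in> F \<Longrightarrow> continuous_on UNIV f" and bound: "\<And>f x. f \<in> F \<Longrightarrow> \<bar>f x\<bar> \<le> 1"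
    and \<eta>: "\<eta> > 0" and V: "open V" "V \<inter> measure_center T \<noteq> {}"
  shows "\<exists>ws. admissible ws \<and> total_length ws > 0 \<and> (\<forall>z\<in>shadow T g ws.
    (\<forall>f\<in>F. \<bar>birkhoff T (total_length ws) f z - total_length ws * integral\<^sup>L \<alpha> f\<bar> \<le> \<eta> * total_length ws) \<and>
    (\<exists>j<total_length ws. (T ^^ j) z \<in> V))"
proof -
  have \<alpha>p: "\<alpha> \<in> borel_prob" using \<alpha> by (simp add: invariant_measures_def)
  then interpret prob_space \<alpha> by (simp add: borel_prob_def)
  obtain \<epsilon>0 where \<epsilon>0: "\<epsilon>0 > 0" "\<And>\<epsilon>. \<epsilon> \<le> \<epsilon>0 \<Longrightarrow> \<forall>\<^sub>F n in sequentially.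
      \<exists>y. \<forall>z\<in>blowup_ball T g n y \<epsilon>. \<exists>j<n. (T ^^ j) z \<in> V"
    using visiting_segment[OF V] by blast
  obtain d where d: "d > 0" "\<And>f x y. f \<in> F \<Longrightarrow> dist x y < d \<Longrightarrow> \<bar>f x - f y\<bar> \<le> \<eta> / 3"
    using uniform_modulus[OF compact_space F cont, of "\<eta> / 3"] \<eta> by auto
  define \<epsilon> where "\<epsilon> = min \<epsilon>0 (d / 2)"
  have \<epsilon>: "\<epsilon> > 0" "\<epsilon> \<le> \<epsilon>0" "\<epsilon> < d" using \<epsilon>0(1) d(1) by (auto simp: \<epsilon>_def)
  have "\<forall>\<^sub>F n in sequentially. real (g n) < \<eta> / 6 * real n"
    by (rule g_small) (use \<eta> in simp)
  with \<epsilon>0(2)[OF \<epsilon>(2)] have "\<forall>\<^sub>F n in sequentially. n \<ge> m \<epsilon> \<and> n > 0 \<and> real (g n) < \<eta> / 6 * real n \<and>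
      (\<exists>y. \<forall>z\<in>blowup_ball T g n y \<epsilon>. \<exists>j<n. (T ^^ j) z \<in> V)"
    using eventually_ge_at_top[of "m \<epsilon>"] eventually_gt_at_top[of "0::nat"]
    by eventually_elim (intro conjI)
  from eventually_happens'[OF sequentially_bot this] obtain n v where
    n: "n \<ge> m \<epsilon>" "n > 0" "real (g n) < \<eta> / 6 * real n"
    and v: "\<And>z. z \<in> blowup_ball T g n v \<epsilon> \<Longrightarrow> \<exists>j<n. (T ^^ j) z \<in> V"
    by (elim exE conjE) metis
  define h where "h f y = birkhoff T n f y - n * integral\<^sup>L \<alpha> f" for f y
  have int: "integrable \<alpha> f" if "f \<in> F" for f
    using integrable_continuous_compact[OF compact_space cont[OF that] \<alpha>p] .
  have mean: "\<bar>integral\<^sup>L \<alpha> f\<bar> \<le> 1" if "f \<in> F" for f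
    using abs_integral_diff_le[OF int[OF that], of "\<lambda>_. 0" 1] bound[OF that] by simp
  have "\<exists>ys. ys \<noteq> [] \<and> hd ys = v \<and> (\<forall>f\<in>F. \<bar>\<Sum>y\<leftarrow>ys. h f y\<bar> \<le> \<eta> / 3 * n * length ys)"
  proof (rule balanced_sample[OF F])
    fix f assume f: "f \<in> F"
    show "integrable \<alpha> (h f)" "integral\<^sup>L \<alpha> (h f) = 0"
      using integral_birkhoff[OF \<alpha> T_measurable int[OF f], of n]
      by (simp_all add: h_def[abs_def] prob_space)
    show "\<bar>h f y\<bar> \<le> 2 * n" for y
    proof -
      have "\<bar>birkhoff T n f y\<bar> \<le> real n * 1" by (rule birkhoff_bound) (rule bound[OF f])
      moreover have "\<bar>real n * integral\<^sup>L \<alpha> f\<bar> \<le> real n * 1"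
        using mean[OF f] by (simp add: abs_mult mult_left_le)
      ultimately show ?thesis unfolding h_def by linarith
    qed
  qed (use \<eta> n in simp)
  then obtain ys where ys: "ys \<noteq> []" "hd ys = v"
    "\<And>f. f \<in> F \<Longrightarrow> \<bar>\<Sum>y\<leftarrow>ys. h f y\<bar> \<le> \<eta> / 3 * n * length ys" by blast
  let ?ws = "map (\<lambda>y. (y, n, \<epsilon>)) ys"
  show ?thesis
  proof (intro exI[of _ ?ws] conjI ballI)
    show "admissible ?ws" using n \<epsilon> by (auto simp: admissible_def)
    show "total_length ?ws > 0" using ys(1) n(2) by (simp add: total_length_map)
    fix z assume z: "z \<in> shadow T g ?ws"
    have "z \<in> blowup_ball T g n v \<epsilon>" using z ys(1,2) by (cases ys) auto
    then obtain j where "j < n" "(T ^^ j) z \<in> V" using v by blast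
    moreover have "n \<le> length ys * n" using ys(1) by (cases ys) auto
    ultimately show "\<exists>j<total_length ?ws. (T ^^ j) z \<in> V"
      unfolding total_length_map using less_le_trans by blast
    fix f assume f: "f \<in> F"
    have shad: "\<bar>birkhoff T n f z - birkhoff T n f y\<bar> \<le> n * (\<eta> / 3) + 2 * real (g n)"
      if "z \<in> blowup_ball T g n y \<epsilon>" for y z
      by (rule birkhoff_blowup_ball[OF _ bound[OF f] _ that]) (use d(2)[OF f] \<epsilon>(3) \<eta> in auto)
    have "\<bar>birkhoff T n f z - birkhoff T n f y\<bar> \<le> \<eta> * 2 / 3 * n"
      if "z \<in> blowup_ball T g n y \<epsilon>" for y z
      using n(3) shad[OF that] by (simp add: algebra_simps)
    from birkhoff_shadow_map[OF this z]
    have "\<bar>birkhoff T (length ys * n) f z - (\<Sum>y\<leftarrow>ys. birkhoff T n f y)\<bar> \<le> 2 / 3 * (\<eta> * (length ys * n))"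
      by (simp add: algebra_simps)
    moreover have "(\<Sum>y\<leftarrow>ys. birkhoff T n f y) = (\<Sum>y\<leftarrow>ys. h f y) + length ys * n * integral\<^sup>L \<alpha> f"
      by (induction ys) (simp_all add: h_def algebra_simps)
    moreover have "\<bar>\<Sum>y\<leftarrow>ys. h f y\<bar> \<le> 1 / 3 * (\<eta> * (length ys * n))"
      using ys(3)[OF f] by (simp add: algebra_simps)
    ultimately have "\<bar>birkhoff T (length ys * n) f z - length ys * n * integral\<^sup>L \<alpha> f\<bar> \<le> \<eta> * (length ys * n)"
      by linarith
    then show "\<bar>birkhoff T (total_length ?ws) f z - total_length ?ws * integral\<^sup>L \<alpha> f\<bar> \<le> \<eta> * total_length ?ws"
      by (simp add: total_length_map)
  qed
qed

end

section \<open>Concatenating repeated blocks\<close>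

text \<open>The stage to which a time belongs, when stage \<open>k\<close> starts at time \<open>R k\<close>.\<close>

lemma strict_mono_bracket:
  fixes R :: "nat \<Rightarrow> nat"
  assumes "strict_mono R" "R 0 = 0"
  shows "\<exists>\<kappa>. (\<forall>n. R (\<kappa> n) \<le> n \<and> n < R (Suc (\<kappa> n))) \<and> (\<forall>k. \<kappa> (R k) = k) \<and>
    filterlim \<kappa> at_top sequentially"
proof -
  have "\<exists>k. R k \<le> n \<and> n < R (Suc k)" for n
  proof (induction n)
    case 0
    then show ?case using assms strict_monoD[OF assms(1), of 0 1] by (intro exI[of _ 0]) simp
  next
    case (Suc n)
    then obtain k where k: "R k \<le> n" "n < R (Suc k)" by blast
    show ?case
    proof (cases "Suc n < R (Suc k)")
      case True
      then show ?thesis using k by (intro exI[of _ k]) simp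
    next
      case False
      then show ?thesis using k strict_monoD[OF assms(1), of "Suc k" "Suc (Suc k)"]
        by (intro exI[of _ "Suc k"]) simp
    qed
  qed
  then obtain \<kappa> where \<kappa>: "\<And>n. R (\<kappa> n) \<le> n \<and> n < R (Suc (\<kappa> n))" by metis
  have ge: "\<kappa> n \<ge> k" if "R k \<le> n" for n k
  proof -
    have "R k < R (Suc (\<kappa> n))" using that \<kappa>[of n] by simp
    then show ?thesis using strict_mono_less[OF assms(1)] by simp
  qed
  show ?thesis
  proof (intro exI[of _ \<kappa>] conjI allI)
    show "R (\<kappa> n) \<le> n" "n < R (Suc (\<kappa> n))" for n using \<kappa> by blast+
    show "\<kappa> (R k) = k" for k
    proof -
      have "R (\<kappa> (R k)) \<le> R k" using \<kappa> by blast
      then show ?thesis using ge[of k "R k"] strict_mono_less_eq[OF assms(1)] by simp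
    qed
    show "filterlim \<kappa> at_top sequentially"
      unfolding filterlim_at_top eventually_sequentially using ge by blast
  qed
qed

lemma omega_limit_iff:
  "c \<in> omega_limit T z \<longleftrightarrow> (\<forall>\<delta>>0. \<forall>N. \<exists>k\<ge>N. dist ((T ^^ k) z) (c :: 'a::metric_space) < \<delta>)"
  unfolding omega_limit_def by (fastforce simp: closure_approachable)

lemma omega_limit_shift: "omega_limit T ((T ^^ M) z) \<subseteq> omega_limit T (z :: 'a::metric_space)"
proof
  fix c assume c: "c \<in> omega_limit T ((T ^^ M) z)"
  show "c \<in> omega_limit T z"
    unfolding omega_limit_iff
  proof (intro allI impI)
    fix \<delta> :: real and N :: nat assume "\<delta> > 0"
    then obtain k where "k \<ge> N" "dist ((T ^^ k) ((T ^^ M) z)) c < \<delta>"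
      using c unfolding omega_limit_iff by blast
    then show "\<exists>k\<ge>N. dist ((T ^^ k) z) c < \<delta>"
      by (intro exI[of _ "M + k"]) (simp add: funpow_funpow)
  qed
qed

text \<open>
  Stage \<open>k\<close> consists of \<open>r k\<close> copies of a block of length \<open>b k\<close> with average close to \<open>q k\<close>. By the choice
  of \<open>r k\<close>, the start \<open>R k\<close> of the stage and the length \<open>b (Suc k)\<close> of the next block are at most
  \<open>R (Suc k) / (k + 1)\<close>. So at the end of stage \<open>k\<close> only this stage counts, and during the next stage,
  whose blocks average to about \<open>q (Suc k)\<close>, an incomplete block costs little; the past contributes
  \<open>q k\<close> instead of \<open>q (Suc k)\<close>, which is paid for by the last term.
\<close>

lemma repeated_blocks_average:
  fixes R r b :: "nat \<Rightarrow> nat" and q :: "nat \<Rightarrow> real"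
  assumes R_Suc: "\<And>k. R (Suc k) = R k + r k * b k"
    and r: "\<And>k. r k = Suc k * (R k + b (Suc k))"
    and b_pos: "\<And>k. b k > 0"
    and bound: "\<And>y. \<bar>f y\<bar> \<le> 1"
    and q_bound: "\<And>k. \<bar>q k\<bar> \<le> 1"
    and block: "\<And>k u. k \<ge> i \<Longrightarrow> u < r k \<Longrightarrow>
      \<bar>birkhoff T (b k) f ((T ^^ (R k + u * b k)) z) - b k * q k\<bar> \<le> 1 / Suc k * b k"
    and k: "k \<ge> i" and n: "R (Suc k) \<le> n" "n < R (Suc (Suc k))"
  shows "\<bar>birkhoff T n f z - n * q (Suc k)\<bar> \<le> n * (6 / Suc k + \<bar>q k - q (Suc k)\<bar>)"
proof -
  define A where "A n = birkhoff T n f z" for n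
  have A_add: "A (l + n) = A l + birkhoff T n f ((T ^^ l) z)" for l n
    unfolding A_def by (rule birkhoff_add)
  have A_bound: "\<bar>A n\<bar> \<le> n" for n
    using birkhoff_bound[of f 1 T n z] bound by (simp add: A_def)
  have run: "\<bar>A (R k + u * b k) - A (R k) - real (u * b k) * q k\<bar> \<le> 1 / Suc k * real (u * b k)"
    if "k \<ge> i" "u \<le> r k" for k u
    using that(2)
  proof (induction u)
    case (Suc u)
    have "A (R k + Suc u * b k) = A (R k + u * b k) + birkhoff T (b k) f ((T ^^ (R k + u * b k)) z)"
      using A_add[of "R k + u * b k" "b k"] by (simp add: add_ac)
    moreover have "real (Suc u * b k) * q k = real (u * b k) * q k + b k * q k"
      "1 / Suc k * real (Suc u * b k) = 1 / Suc k * real (u * b k) + 1 / Suc k * b k"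
      by (simp_all add: algebra_simps add_divide_distrib)
    ultimately show ?case using Suc block[OF that(1), of u] by simp
  qed simp
  define e where "e = 1 / real (Suc k)"
  have e: "e > 0" "1 / real (Suc (Suc k)) \<le> e" by (simp_all add: e_def frac_le)
  have r_b: "real (R k) \<le> e * R (Suc k)" "real (b (Suc k)) \<le> e * R (Suc k)"
  proof -
    have "Suc k * (R k + b (Suc k)) * 1 \<le> r k * b k"
      unfolding r using b_pos[of k] by (intro mult_le_mono2) simp
    then have "Suc k * (R k + b (Suc k)) \<le> R (Suc k)" unfolding R_Suc by simp
    then have "real (Suc k) * (R k + b (Suc k)) \<le> R (Suc k)"
      by (metis of_nat_le_iff of_nat_mult)
    then have "real (R k) + b (Suc k) \<le> e * R (Suc k)"
      unfolding e_def by (simp add: field_simps)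
    then show "real (R k) \<le> e * R (Suc k)" "real (b (Suc k)) \<le> e * R (Suc k)" by linarith+
  qed
  have start: "\<bar>A (R (Suc k)) - R (Suc k) * q k\<bar> \<le> 3 * e * R (Suc k)"
  proof -
    have "\<bar>A (R (Suc k)) - A (R k) - real (r k * b k) * q k\<bar> \<le> e * real (r k * b k)"
      using run[OF k, of "r k"] by (simp add: R_Suc e_def)
    moreover have "real (R (Suc k)) * q k = R k * q k + real (r k * b k) * q k"
      unfolding R_Suc by (simp add: algebra_simps)
    moreover have "\<bar>R k * q k\<bar> \<le> R k" using q_bound[of k] by (simp add: abs_mult mult_left_le)
    moreover have "e * real (r k * b k) \<le> e * R (Suc k)" using e(1) unfolding R_Suc by simp
    ultimately show ?thesis using A_bound[of "R k"] r_b(1) by linarith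
  qed
  define u where "u = (n - R (Suc k)) div b (Suc k)"
  \<comment> \<open>length of the incomplete block at the end\<close>
  define w where "w = (n - R (Suc k)) mod b (Suc k)"
  have n_eq: "n = R (Suc k) + u * b (Suc k) + w"
    using n(1) by (simp add: u_def w_def)
  have w: "w < b (Suc k)" using b_pos by (simp add: w_def)
  have u: "u \<le> r (Suc k)"
  proof (rule ccontr)
    assume "\<not> u \<le> r (Suc k)"
    then have "r (Suc k) * b (Suc k) \<le> u * b (Suc k)" by (intro mult_le_mono1) simp
    then show False using n(2) n_eq unfolding R_Suc[of "Suc k"] by linarith
  qed
  let ?l = "R (Suc k) + u * b (Suc k)"
  let ?q = "q (Suc k)"
  have "\<bar>A ?l - A (R (Suc k)) - real (u * b (Suc k)) * ?q\<bar> \<le> e * real (u * b (Suc k))"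
    using run[of "Suc k" u] k u e(2) mult_right_mono[OF e(2), of "real (u * b (Suc k))"] by simp
  moreover have "\<bar>A n - A ?l\<bar> \<le> w"
    using A_add[of ?l w] birkhoff_bound[of f 1 T w "(T ^^ ?l) z"] bound n_eq by simp
  moreover have "\<bar>w * ?q\<bar> \<le> w" using q_bound[of "Suc k"] by (simp add: abs_mult mult_left_le)
  moreover have "real n * ?q = R (Suc k) * ?q + real (u * b (Suc k)) * ?q + w * ?q"
    unfolding n_eq by (simp add: algebra_simps)
  moreover have "R (Suc k) * ?q = R (Suc k) * q k - R (Suc k) * (q k - ?q)"
    by (simp add: algebra_simps)
  moreover have "\<bar>R (Suc k) * (q k - ?q)\<bar> \<le> n * \<bar>q k - ?q\<bar>"
    using n(1) by (simp add: abs_mult mult_right_mono)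
  moreover have "e * R (Suc k) \<le> e * n" "e * real (u * b (Suc k)) \<le> e * n"
    using e(1) n_eq by simp_all
  ultimately have "\<bar>A n - n * ?q\<bar> \<le> 6 * (e * n) + n * \<bar>q k - ?q\<bar>"
    using start r_b(2) w by linarith
  then show ?thesis by (simp add: A_def e_def algebra_simps)
qed

section \<open>Points of a saturated set with a prescribed orbit segment\<close>

locale tracked_system = almost_product T g m + weak_coordinates \<phi>
  for T :: "'a::metric_space \<Rightarrow> 'a" and g m and \<phi> :: "nat \<Rightarrow> 'a \<Rightarrow> real"
begin

text \<open>
  The \<open>k\<close>-th list is \<open>r k\<close> copies of a block that approximates \<open>\<alpha> k\<close> in the coordinates \<open>\<phi> 0, \<dots>, \<phi> k\<close>
  and visits the ball of radius \<open>1 / (k + 1)\<close> around \<open>c k\<close>, where \<open>c\<close> is a dense recurrent sequence in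
  the measure center. The averages of a shadowing orbit follow the sequence of the \<open>\<alpha> k\<close>, hence they
  accumulate exactly at \<open>K\<close>, and the visits put the whole measure center into the \<open>\<omega>\<close>-limit set.
\<close>

lemma tail_exists:
  assumes K: "K \<subseteq> invariant_measures T" "K \<noteq> {}" "compactin weak_star K" "connectedin weak_star K"
    and C: "measure_center T \<noteq> {}"
  shows "\<exists>W. (\<forall>k. admissible (W k)) \<and>
    (\<forall>z. (\<forall>k. (T ^^ total_length (concat (map W [0..<k]))) z \<in> shadow T g (W k)) \<longrightarrow>
      z \<in> saturated_set T K \<and> measure_center T \<subseteq> omega_limit T z)"
proof -
  let ?Q = "coords ` K"
  have K_prob: "K \<subseteq> borel_prob" using K(1) by (auto simp: invariant_measures_def)
  have Q: "compact ?Q" "connected ?Q" "?Q \<noteq> {}"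
    using image_compactin[OF K(3) continuous_map_coords]
      connectedin_continuous_map_image[OF continuous_map_coords K(4)] K(2) by auto
  from slow_dense_sequence[OF Q] obtain q :: "nat \<Rightarrow> nat \<Rightarrow> real" where
    q: "\<forall>k. q k \<in> ?Q" "(\<lambda>k. dist (q k) (q (Suc k))) \<longlonglongrightarrow> 0"
    "\<forall>p\<in>?Q. \<forall>\<delta>>0. \<exists>\<^sub>\<infinity>k. dist (q k) p < \<delta>"
    by (elim exE conjE)
  note q = q(1)[rule_format] q(2) q(3)[rule_format]
  have "\<forall>k. \<exists>\<beta>. \<beta> \<in> K \<and> q k = coords \<beta>" using q(1) by blast
  from choice[OF this] obtain \<alpha> where "\<forall>k. \<alpha> k \<in> K \<and> q k = coords (\<alpha> k)" ..
  then have \<alpha>: "\<alpha> k \<in> K" "q k = coords (\<alpha> k)" for k by simp_all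
  have "compact (measure_center T)"
    unfolding measure_center_def using compact_Int_closed[OF almost_product_axioms[THEN almost_product.compact_space] closed_closure] by simp
  from dense_recurrent_sequence[OF this C] obtain c :: "nat \<Rightarrow> 'a" where
    c: "\<forall>k. c k \<in> measure_center T"
    "\<forall>x\<in>measure_center T. \<forall>\<delta>>0. \<exists>\<^sub>\<infinity>k. dist (c k) x < \<delta>"
    by (elim exE conjE)
  note c = c(1)[rule_format] c(2)[rule_format]
  have "\<exists>ws. admissible ws \<and> total_length ws > 0 \<and> (\<forall>z\<in>shadow T g ws.
    (\<forall>f\<in>\<phi> ` {..k}. \<bar>birkhoff T (total_length ws) f z - total_length ws * integral\<^sup>L (\<alpha> k) f\<bar> \<le> 1 / Suc k * total_length ws) \<and>
    (\<exists>j<total_length ws. (T ^^ j) z \<in> ball (c k) (1 / Suc k)))" for k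
  proof (rule block_exists)
    show "\<alpha> k \<in> invariant_measures T" using \<alpha>(1) K(1) by blast
    have "c k \<in> ball (c k) (1 / Suc k)" by simp
    then show "ball (c k) (1 / Suc k) \<inter> measure_center T \<noteq> {}" using c(1) by blast
  qed (auto simp: \<phi>_cont \<phi>_bound)
  then obtain B where B: "\<And>k. admissible (B k)" "\<And>k. total_length (B k) > 0"
    "\<And>k z f. z \<in> shadow T g (B k) \<Longrightarrow> f \<in> \<phi> ` {..k} \<Longrightarrow>
      \<bar>birkhoff T (total_length (B k)) f z - total_length (B k) * integral\<^sup>L (\<alpha> k) f\<bar> \<le> 1 / Suc k * total_length (B k)"
    "\<And>k z. z \<in> shadow T g (B k) \<Longrightarrow> \<exists>j<total_length (B k). (T ^^ j) z \<in> ball (c k) (1 / Suc k)"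
    by metis
  define b where "b k = total_length (B k)" for k
  \<comment> \<open>the number \<open>r k\<close> of repetitions makes stage \<open>k\<close> dominate its past and one block of the next stage\<close>
  define R where "R = rec_nat 0 (\<lambda>k Rk. Rk + Suc k * (Rk + b (Suc k)) * b k)"
  define r where "r k = Suc k * (R k + b (Suc k))" for k
  have R0: "R 0 = 0" and R_Suc: "R (Suc k) = R k + r k * b k" for k
    by (simp_all add: R_def r_def)
  have b_pos: "b k > 0" for k using B(2) by (simp add: b_def)
  have r_pos: "r k > 0" for k using b_pos by (simp add: r_def)
  have "strict_mono R" using r_pos b_pos by (simp add: strict_mono_Suc_iff R_Suc)
  from strict_mono_bracket[OF \<open>strict_mono R\<close> R0] obtain \<kappa> where
    \<kappa>: "\<forall>n. R (\<kappa> n) \<le> n \<and> n < R (Suc (\<kappa> n))" "\<forall>k. \<kappa> (R k) = k"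
    "filterlim \<kappa> at_top sequentially"
    by (elim exE conjE)
  define W where "W k = concat (replicate (r k) (B k))" for k
  have R_eq: "total_length (concat (map W [0..<k])) = R k" for k
    by (induction k) (simp_all add: R0 R_Suc total_length_append W_def total_length_replicate b_def)
  show ?thesis
  proof (intro exI[of _ W] conjI allI impI)
    show "admissible (W k)" for k using B(1)[of k] by (auto simp: W_def admissible_def)
    fix z assume "\<forall>k. (T ^^ total_length (concat (map W [0..<k]))) z \<in> shadow T g (W k)"
    then have "(T ^^ (u * b k)) ((T ^^ R k) z) \<in> shadow T g (B k)" if "u < r k" for k u
      using shadow_replicate[OF _ that] unfolding R_eq W_def b_def by blast
    then have sh: "(T ^^ (R k + u * b k)) z \<in> shadow T g (B k)" if "u < r k" for k u
      using that by (simp add: funpow_funpow)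
    have "(\<lambda>n. dist (averages T z n) (q (\<kappa> n))) \<longlonglongrightarrow> 0"
    proof (rule dist_fun_tendsto_0)
      fix i
      have est: "\<bar>averages T z n i - q (\<kappa> n) i\<bar> \<le> 6 / real (\<kappa> n) + \<bar>q (\<kappa> n - 1) i - q (\<kappa> n) i\<bar>"
        if "\<kappa> n \<ge> Suc i" for n
      proof -
        obtain k where k: "\<kappa> n = Suc k" "k \<ge> i" using \<open>\<kappa> n \<ge> Suc i\<close> by (cases "\<kappa> n") auto
        have qi: "q k i = integral\<^sup>L (\<alpha> k) (\<phi> i)" for k by (simp add: \<alpha>(2) coords_def)
        have q1: "\<bar>q k i\<bar> \<le> 1" for k
        proof -
          have ap: "\<alpha> k \<in> borel_prob" using \<alpha>(1) K_prob by blast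
          then interpret prob_space "\<alpha> k" by (simp add: borel_prob_def)
          show ?thesis
            using abs_integral_diff_le[OF integrable_continuous[OF \<phi>_cont ap], of "\<lambda>_. 0" i 1] \<phi>_bound
            by (simp add: qi)
        qed
        have n: "R (Suc k) \<le> n" "n < R (Suc (Suc k))" using spec[OF \<kappa>(1), of n] k by auto
        have "\<bar>birkhoff T n (\<phi> i) z - n * q (Suc k) i\<bar> \<le> n * (6 / Suc k + \<bar>q k i - q (Suc k) i\<bar>)"
        proof (rule repeated_blocks_average[OF R_Suc r_def b_pos _ q1 _ k(2) n])
          show "\<bar>\<phi> i y\<bar> \<le> 1" for y by (rule \<phi>_bound)
          fix k u assume "i \<le> k" "u < r k"
          then show "\<bar>birkhoff T (b k) (\<phi> i) ((T ^^ (R k + u * b k)) z) - real (b k) * q k i\<bar>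
              \<le> 1 / real (Suc k) * real (b k)"
            using B(3)[OF sh, of u k "\<phi> i"] by (simp add: b_def qi)
        qed
        moreover have "n > 0" using n(1) strict_monoD[OF \<open>strict_mono R\<close>, of 0 "Suc k"] by (cases n) auto
        moreover have "birkhoff T n (\<phi> i) z = n * averages T z n i"
          using \<open>n > 0\<close> by (simp add: birkhoff_def averages_def)
        ultimately have "real n * \<bar>averages T z n i - q (Suc k) i\<bar> \<le> n * (6 / Suc k + \<bar>q k i - q (Suc k) i\<bar>)"
          by (simp add: abs_mult flip: right_diff_distrib)
        then show ?thesis using \<open>n > 0\<close> k(1) by simp
      qed
      have "(\<lambda>k. \<bar>q k i - q (Suc k) i\<bar>) \<longlonglongrightarrow> 0" by (rule coordinate_tendsto_0[OF q(2)])
      then have "(\<lambda>k. \<bar>q (k - 1) i - q (Suc (k - 1)) i\<bar>) \<longlonglongrightarrow> 0"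
        by (rule filterlim_compose) (rule filterlim_minus_const_nat_at_top)
      moreover have "\<forall>\<^sub>F k in sequentially. \<bar>q (k - 1) i - q (Suc (k - 1)) i\<bar> = \<bar>q (k - 1) i - q k i\<bar>"
        using eventually_gt_at_top[of 0] by eventually_elim simp
      ultimately have "(\<lambda>k. \<bar>q (k - 1) i - q k i\<bar>) \<longlonglongrightarrow> 0"
        by (rule Lim_transform_eventually)
      moreover have "(\<lambda>k. 6 / real k) \<longlonglongrightarrow> 0" by (rule lim_const_over_n)
      ultimately have "(\<lambda>k. 6 / real k + \<bar>q (k - 1) i - q k i\<bar>) \<longlonglongrightarrow> 0 + 0" by (intro tendsto_add)
      then have "(\<lambda>n. 6 / real (\<kappa> n) + \<bar>q (\<kappa> n - 1) i - q (\<kappa> n) i\<bar>) \<longlonglongrightarrow> 0"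
        using filterlim_compose[OF _ \<kappa>(3)] by simp
      moreover have "\<forall>\<^sub>F n in sequentially. norm \<bar>averages T z n i - q (\<kappa> n) i\<bar> \<le>
          6 / real (\<kappa> n) + \<bar>q (\<kappa> n - 1) i - q (\<kappa> n) i\<bar>"
        using spec[OF \<kappa>(3)[unfolded filterlim_at_top], of "Suc i"]
        by eventually_elim (simp only: real_norm_def abs_abs est)
      ultimately show "(\<lambda>n. \<bar>averages T z n i - q (\<kappa> n) i\<bar>) \<longlonglongrightarrow> 0"
        by (rule Lim_null_comparison[rotated])
    qed
    then have close: "\<forall>\<^sub>F n in sequentially. dist (averages T z n) (q (\<kappa> n)) < \<delta>" if "\<delta> > 0" for \<delta>
      using that by (rule order_tendstoD)
    have "acc_measures T z = K"
    proof (intro equalityI subsetI)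
      fix \<mu> assume \<mu>: "\<mu> \<in> acc_measures T z"
      have "coords \<mu> \<in> closure ?Q"
        unfolding closure_approachable
      proof (intro allI impI)
        fix \<delta> :: real assume "\<delta> > 0"
        then have "\<exists>\<^sub>\<infinity>n. dist (averages T z n) (coords \<mu>) < \<delta> / 2"
          using \<mu> half_gt_zero unfolding acc_measures_iff by blast
        moreover have "\<forall>\<^sub>\<infinity>n. dist (averages T z n) (q (\<kappa> n)) < \<delta> / 2"
          unfolding cofinite_eq_sequentially by (rule close[OF half_gt_zero[OF \<open>\<delta> > 0\<close>]])
        ultimately have "\<exists>\<^sub>\<infinity>n. dist (averages T z n) (coords \<mu>) < \<delta> / 2 \<and>
            dist (averages T z n) (q (\<kappa> n)) < \<delta> / 2" by (rule INFM_conjI)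
        then obtain n where "dist (averages T z n) (coords \<mu>) < \<delta> / 2"
          "dist (averages T z n) (q (\<kappa> n)) < \<delta> / 2" using INFM_EX by blast
        then have "dist (q (\<kappa> n)) (coords \<mu>) < \<delta>" by (metis dist_commute dist_triangle_half_r)
        then show "\<exists>y\<in>?Q. dist y (coords \<mu>) < \<delta>" using q(1) by blast
      qed
      then have "coords \<mu> \<in> ?Q" using compact_imp_closed[OF Q(1)] by simp
      then obtain \<beta> where "\<beta> \<in> K" "coords \<mu> = coords \<beta>" by blast
      moreover have "\<mu> \<in> borel_prob" using \<mu> by (simp add: acc_measures_iff)
      ultimately show "\<mu> \<in> K" using coords_inj K_prob by blast
    next
      fix \<mu> assume \<mu>: "\<mu> \<in> K"
      show "\<mu> \<in> acc_measures T z"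
        unfolding acc_measures_iff
      proof (intro conjI allI impI)
        show "\<mu> \<in> borel_prob" using \<mu> K_prob by blast
        fix \<delta> :: real assume \<delta>: "\<delta> > 0"
        show "\<exists>\<^sub>\<infinity>n. dist (averages T z n) (coords \<mu>) < \<delta>"
          unfolding INFM_nat_le
        proof
          fix N
          obtain N' where N': "\<And>n. n \<ge> N' \<Longrightarrow> dist (averages T z n) (q (\<kappa> n)) < \<delta> / 2"
            using close[OF half_gt_zero[OF \<delta>]] unfolding eventually_sequentially by blast
          have "\<exists>\<^sub>\<infinity>k. dist (q k) (coords \<mu>) < \<delta> / 2"
            using q(3)[OF imageI[OF \<mu>] half_gt_zero[OF \<delta>]] .
          then obtain k where k: "k \<ge> max N N'" "dist (q k) (coords \<mu>) < \<delta> / 2"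
            unfolding INFM_nat_le by blast
          have "R k \<ge> k" using strict_mono_imp_increasing[OF \<open>strict_mono R\<close>] .
          then have "dist (averages T z (R k)) (q k) < \<delta> / 2" using N'[of "R k"] k(1) \<kappa>(2) by simp
          then have "dist (averages T z (R k)) (coords \<mu>) < \<delta>"
            using k(2) dist_triangle_half_r dist_commute by metis
          then show "\<exists>n\<ge>N. dist (averages T z n) (coords \<mu>) < \<delta>"
            using \<open>R k \<ge> k\<close> k(1) by (intro exI[of _ "R k"]) auto
        qed
      qed
    qed
    then show "z \<in> saturated_set T K" by (simp add: saturated_set_def)
    show "measure_center T \<subseteq> omega_limit T z"
    proof
      fix x assume x: "x \<in> measure_center T"
      show "x \<in> omega_limit T z"
        unfolding omega_limit_iff
      proof (intro allI impI)
        fix \<delta> :: real and N :: nat assume \<delta>: "\<delta> > 0"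
        obtain N' where N': "1 / real (Suc N') < \<delta> / 2" using nat_approx_posE half_gt_zero[OF \<delta>] by blast
        obtain k where k: "k \<ge> max N N'" "dist (c k) x < \<delta> / 2"
          using c(2)[OF x half_gt_zero[OF \<delta>]] unfolding INFM_nat_le by blast
        obtain j where "(T ^^ j) ((T ^^ R k) z) \<in> ball (c k) (1 / Suc k)"
          using B(4)[OF sh[of 0 k]] r_pos by auto
        moreover have "1 / real (Suc k) \<le> 1 / real (Suc N')" using k(1) by (simp add: frac_le)
        ultimately have "dist (c k) ((T ^^ (R k + j)) z) < \<delta> / 2"
          using N' by (simp add: funpow_funpow)
        then have "dist ((T ^^ (R k + j)) z) x < \<delta>" using k(2) dist_triangle_half_r by blast
        moreover have "R k + j \<ge> N"
          using strict_mono_imp_increasing[OF \<open>strict_mono R\<close>, of k] k(1) by simp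
        ultimately show "\<exists>n\<ge>N. dist ((T ^^ n) z) x < \<delta>" by blast
      qed
    qed
  qed
qed

text \<open>
  The visit to \<open>U\<close> happens at some time \<open>j < N\<close>, and the orbit is started there; the prescribed
  segment is then followed from time \<open>k = N - j\<close> on.
\<close>

lemma saturated_shadowing_points:
  assumes K: "K \<subseteq> invariant_measures T" "K \<noteq> {}" "compactin weak_star K" "connectedin weak_star K"
    and U: "open U" "U \<inter> measure_center T \<noteq> {}"
  shows "\<exists>N. \<forall>\<epsilon>>0. \<forall>n\<ge>m \<epsilon>. \<forall>x.
    \<exists>z\<in>saturated_set T K \<inter> U \<inter> {z. measure_center T \<subseteq> omega_limit T z}.
      \<exists>k\<le>N. (T ^^ k) z \<in> blowup_ball T g n x \<epsilon>"
proof -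
  obtain W where W: "\<And>k. admissible (W k)"
    "\<And>z. (\<And>k. (T ^^ total_length (concat (map W [0..<k]))) z \<in> shadow T g (W k)) \<Longrightarrow>
      z \<in> saturated_set T K \<and> measure_center T \<subseteq> omega_limit T z"
    using tail_exists[OF K] U(2) by blast
  obtain \<epsilon>0 where \<epsilon>0: "\<epsilon>0 > 0" "\<forall>\<^sub>F n in sequentially.
      \<exists>y. \<forall>z\<in>blowup_ball T g n y \<epsilon>0. \<exists>j<n. (T ^^ j) z \<in> U"
    using visiting_segment[OF U] by blast
  from \<epsilon>0(2) eventually_ge_at_top[of "m \<epsilon>0"]
  have "\<forall>\<^sub>F n in sequentially. n \<ge> m \<epsilon>0 \<and> (\<exists>y. \<forall>z\<in>blowup_ball T g n y \<epsilon>0. \<exists>j<n. (T ^^ j) z \<in> U)"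
    by eventually_elim (intro conjI)
  from eventually_happens'[OF sequentially_bot this] obtain N y where
    N: "N \<ge> m \<epsilon>0" "\<forall>z\<in>blowup_ball T g N y \<epsilon>0. \<exists>j<N. (T ^^ j) z \<in> U" by blast
  show ?thesis
  proof (intro exI[of _ N] allI impI)
    fix \<epsilon> :: real and n and x :: 'a assume \<epsilon>: "\<epsilon> > 0" and n: "n \<ge> m \<epsilon>"
    define W' where "W' = case_nat [(y, N, \<epsilon>0), (x, n, \<epsilon>)] W"
    have "admissible (W' k)" for k
      using W(1) N(1) \<epsilon>0(1) \<epsilon> n by (cases k) (auto simp: W'_def admissible_def)
    then obtain z where z: "\<And>k. (T ^^ total_length (concat (map W' [0..<k]))) z \<in> shadow T g (W' k)"
      using infinite_shadowing[of W'] by blast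
    have upt: "map W' [0..<Suc k] = W' 0 # map W [0..<k]" for k
      by (subst map_upt_Suc) (simp add: W'_def)
    have "(T ^^ total_length (concat (map W [0..<k]))) ((T ^^ (N + n)) z) \<in> shadow T g (W k)" for k
      using z[of "Suc k"] unfolding upt by (simp add: total_length_append funpow_funpow W'_def add.assoc)
    from W(2)[OF this] have tail: "acc_measures T ((T ^^ (N + n)) z) = K"
      "measure_center T \<subseteq> omega_limit T ((T ^^ (N + n)) z)"
      by (simp_all add: saturated_set_def)
    have first: "z \<in> blowup_ball T g N y \<epsilon>0" "(T ^^ N) z \<in> blowup_ball T g n x \<epsilon>"
      using z[of 0] by (simp_all add: W'_def)
    then obtain j where j: "j < N" "(T ^^ j) z \<in> U" using N(2) by blast
    have "(T ^^ (N - j)) ((T ^^ j) z) = (T ^^ N) z" using j(1) by (simp add: funpow_funpow)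
    moreover have shift: "(T ^^ (N + n - j)) ((T ^^ j) z) = (T ^^ (N + n)) z"
      using j(1) by (simp add: funpow_funpow)
    moreover have "acc_measures T ((T ^^ j) z) = K"
      using tail(1) acc_measures_shift[of T "N + n - j" "(T ^^ j) z"] shift by simp
    moreover have "measure_center T \<subseteq> omega_limit T ((T ^^ j) z)"
      using tail(2) omega_limit_shift[where T = T and M = "N + n - j" and z = "(T ^^ j) z"] shift by auto
    ultimately show "\<exists>z\<in>saturated_set T K \<inter> U \<inter> {z. measure_center T \<subseteq> omega_limit T z}.
      \<exists>k\<le>N. (T ^^ k) z \<in> blowup_ball T g n x \<epsilon>"
      using j(2) first(2) by (intro bexI[of _ "(T ^^ j) z"] exI[of _ "N - j"]) (auto simp: saturated_set_def)
  qed
qed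

end

section \<open>Separated sets and upper capacity entropy\<close>

definition separated :: "('a::metric_space \<Rightarrow> 'a) \<Rightarrow> nat \<Rightarrow> real \<Rightarrow> 'a set \<Rightarrow> bool" where
  "separated T n \<epsilon> E \<longleftrightarrow> finite E \<and> (\<forall>x\<in>E. \<forall>y\<in>E. x \<noteq> y \<longrightarrow> bowen_dist T n x y > \<epsilon>)"

lemma max_separated_eq: "max_separated T n Z \<epsilon> = Sup {card E | E. E \<subseteq> Z \<and> separated T n \<epsilon> E}"
  by (simp add: max_separated_def separated_def)

lemma bowen_dist_le_iff:
  "n > 0 \<Longrightarrow> bowen_dist T n x y \<le> \<epsilon> \<longleftrightarrow> (\<forall>k<n. dist ((T ^^ k) x) ((T ^^ k) y) \<le> \<epsilon>)"
  unfolding bowen_dist_def by (subst Max_le_iff) auto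

text \<open>
  Rounding each of the first \<open>n\<close> iterates to a finite net is injective on a separated set. The bound
  ensures that the supremum in \<open>max_separated\<close> is attained.
\<close>

lemma separated_card_bounded:
  assumes "compact (UNIV :: 'a::metric_space set)" "n > 0" "\<epsilon> > 0"
  shows "\<exists>B. \<forall>E :: 'a set. separated T n \<epsilon> E \<longrightarrow> card E \<le> B"
proof -
  obtain A :: "'a set" where A: "finite A" "\<And>x. \<exists>p\<in>A. dist x p < \<epsilon> / 2"
    using compact_finite_net[OF assms(1), of "\<epsilon> / 2"] assms(3) by auto
  obtain c where c: "\<And>x. c x \<in> A" "\<And>x. dist x (c x) < \<epsilon> / 2" using A(2) by metis
  define code where "code x = (\<lambda>k\<in>{..<n}. c ((T ^^ k) x))" for x
  have "card E \<le> card ({..<n} \<rightarrow>\<^sub>E A)" if E: "separated T n \<epsilon> E" for E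
  proof (rule card_inj_on_le)
    show "code ` E \<subseteq> {..<n} \<rightarrow>\<^sub>E A" by (intro image_subsetI PiE_I) (simp_all add: c code_def)
    show "finite ({..<n} \<rightarrow>\<^sub>E A)" using A(1) by (intro finite_PiE) auto
    show "inj_on code E"
    proof (rule inj_onI, rule ccontr)
      fix x y assume xy: "x \<in> E" "y \<in> E" "code x = code y" "x \<noteq> y"
      have "dist ((T ^^ k) x) ((T ^^ k) y) \<le> \<epsilon>" if "k < n" for k
      proof -
        have "c ((T ^^ k) x) = c ((T ^^ k) y)"
          using fun_cong[OF xy(3), of k] that by (simp add: code_def)
        then show ?thesis
          using c(2)[of "(T ^^ k) x"] c(2)[of "(T ^^ k) y"]
          by (metis dist_commute dist_triangle_half_l less_imp_le)
      qed
      then have "bowen_dist T n x y \<le> \<epsilon>" using assms(2) by (simp add: bowen_dist_le_iff)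
      then show False using E xy by (force simp: separated_def)
    qed
  qed
  then show ?thesis by blast
qed

text \<open>
  Weigh every subset \<open>D\<close> of \<open>{..<n}\<close> by \<open>\<theta> ^ card D\<close>: the total weight is \<open>(1 + \<theta>) ^ n\<close>, and the small sets
  have weight at least \<open>\<theta> ^ k\<close>. For \<open>k = o(n)\<close> this shows that their number is \<open>e\<^bsup>o(n)\<^esup>\<close>.
\<close>

lemma card_small_subsets:
  assumes "0 < \<theta>" "\<theta> \<le> (1::real)"
  shows "real (card {D. D \<subseteq> {..<n} \<and> card D \<le> k}) * \<theta> ^ k \<le> (1 + \<theta>) ^ n"
proof -
  have fin: "finite {D. D \<subseteq> {..<n}}" by (simp add: Collect_mem_eq flip: Pow_def)
  have "real (card {D. D \<subseteq> {..<n} \<and> card D \<le> k}) * \<theta> ^ k = (\<Sum>D | D \<subseteq> {..<n} \<and> card D \<le> k. \<theta> ^ k)"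
    by simp
  also have "\<dots> \<le> (\<Sum>D | D \<subseteq> {..<n} \<and> card D \<le> k. \<theta> ^ card D)"
    using assms by (intro sum_mono power_decreasing) auto
  also have "\<dots> \<le> (\<Sum>D\<in>Pow {..<n}. \<theta> ^ card D)"
    using assms by (intro sum_mono2) auto
  also have "\<dots> = (\<Sum>D\<in>Pow {..<n}. \<Prod>x\<in>D. \<theta>)" by simp
  also have "\<dots> = (\<Prod>x<n. 1 + \<theta>)"
    using prod_add[of "{..<n}" "\<lambda>_. \<theta>" "\<lambda>_. 1"] by (simp add: add.commute)
  finally show ?thesis by simp
qed

context
  fixes T :: "'a::metric_space \<Rightarrow> 'a"
  assumes compact: "compact (UNIV :: 'a set)"
begin

lemma max_separated_ge:
  assumes "n > 0" "\<epsilon> > 0" "E \<subseteq> Z" "separated T n \<epsilon> E"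
  shows "card E \<le> max_separated T n Z \<epsilon>"
proof -
  obtain B where B: "\<And>E :: 'a set. separated T n \<epsilon> E \<Longrightarrow> card E \<le> B"
    using separated_card_bounded[OF compact assms(1,2)] by blast
  have "bdd_above {card E | E. E \<subseteq> Z \<and> separated T n \<epsilon> E}"
    by (rule bdd_aboveI[of _ B]) (auto dest: B)
  then show ?thesis unfolding max_separated_eq using assms by (intro cSup_upper) auto
qed

lemma max_separated_attained:
  assumes "n > 0" "\<epsilon> > 0"
  obtains E where "E \<subseteq> Z" "separated T n \<epsilon> E" "card E = max_separated T n Z \<epsilon>"
proof -
  obtain B where B: "\<And>E :: 'a set. separated T n \<epsilon> E \<Longrightarrow> card E \<le> B"
    using separated_card_bounded[OF compact assms(1,2)] by blast
  define S where "S = {card E | E. E \<subseteq> Z \<and> separated T n \<epsilon> E}"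
  have fin: "finite S" by (rule finite_subset[of _ "{..B}"]) (auto simp: S_def dest: B)
  have "separated T n \<epsilon> {}" by (simp add: separated_def)
  then have ne: "S \<noteq> {}" unfolding S_def by blast
  have "Sup S \<in> S" using Max_in[OF fin ne] cSup_eq_Max[OF fin ne] by simp
  then show ?thesis using that unfolding max_separated_eq S_def by auto
qed

lemma max_separated_mono:
  assumes "n > 0" "\<epsilon> > 0" "\<epsilon> \<le> \<epsilon>'" "Z \<subseteq> Z'"
  shows "max_separated T n Z \<epsilon>' \<le> max_separated T n Z' \<epsilon>"
proof -
  obtain E where E: "E \<subseteq> Z" "separated T n \<epsilon>' E" "card E = max_separated T n Z \<epsilon>'"
    using max_separated_attained[of n \<epsilon>' Z] assms by auto
  then have "separated T n \<epsilon> E" using assms(3) by (force simp: separated_def)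
  then show ?thesis using max_separated_ge[of n \<epsilon> E Z'] E assms by auto
qed

definition growth :: "'a set \<Rightarrow> real \<Rightarrow> nat \<Rightarrow> ereal" where
  "growth Z \<epsilon> n = (let s = max_separated T n Z \<epsilon> in
     if s = 0 then -\<infinity> else ereal (1 / real n * ln (real s)))"

lemma growth_mono:
  assumes "n > 0" "\<epsilon> > 0" "\<epsilon> \<le> \<epsilon>'" "Z \<subseteq> Z'"
  shows "growth Z \<epsilon>' n \<le> growth Z' \<epsilon> n"
  using max_separated_mono[OF assms] assms(1)
  by (auto simp: growth_def Let_def divide_right_mono)

lemma limsup_growth_mono:
  assumes "\<epsilon> > 0" "\<epsilon> \<le> \<epsilon>'" "Z \<subseteq> Z'"
  shows "limsup (growth Z \<epsilon>') \<le> limsup (growth Z' \<epsilon>)"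
proof (rule Limsup_mono)
  show "\<forall>\<^sub>F n in sequentially. growth Z \<epsilon>' n \<le> growth Z' \<epsilon> n"
    using eventually_gt_at_top[of 0] by eventually_elim (rule growth_mono[OF _ assms])
qed

text \<open>The growth rate increases as \<open>\<epsilon>\<close> decreases, so the limit exists and is a supremum.\<close>

lemma upper_capacity_entropy_eq_SUP:
  "upper_capacity_entropy T Z = (SUP \<epsilon>\<in>{0<..}. limsup (growth Z \<epsilon>))"
proof -
  let ?f = "\<lambda>\<epsilon>. limsup (growth Z \<epsilon>)"
  have "(?f \<longlongrightarrow> (SUP \<epsilon>\<in>{0<..}. ?f \<epsilon>)) (at_right 0)"
  proof (rule order_tendstoI)
    fix a assume "a < (SUP \<epsilon>\<in>{0<..}. ?f \<epsilon>)"
    then obtain \<epsilon> where \<epsilon>: "\<epsilon> > 0" "a < ?f \<epsilon>" by (auto simp: less_SUP_iff)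
    have "\<forall>\<^sub>F e in at_right 0. e \<in> {0<..<\<epsilon>}" using \<epsilon>(1) by (rule eventually_at_right_real)
    then show "\<forall>\<^sub>F e in at_right 0. a < ?f e"
    proof eventually_elim
      case (elim e)
      then show ?case using \<epsilon>(2) limsup_growth_mono[of e \<epsilon> Z Z] by (auto intro: less_le_trans)
    qed
  next
    fix a assume a: "(SUP \<epsilon>\<in>{0<..}. ?f \<epsilon>) < a"
    show "\<forall>\<^sub>F e in at_right 0. ?f e < a"
      using eventually_at_right_less[of 0]
    proof eventually_elim
      case (elim e)
      then have "?f e \<le> (SUP \<epsilon>\<in>{0<..}. ?f \<epsilon>)" by (intro SUP_upper) simp
      then show ?case using a by (rule le_less_trans)
    qed
  qed
  then show ?thesis
    unfolding upper_capacity_entropy_def growth_def[abs_def]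
    by (intro tendsto_Lim) simp_all
qed

lemma upper_capacity_entropy_mono:
  assumes "Z \<subseteq> Z'"
  shows "upper_capacity_entropy T Z \<le> upper_capacity_entropy T Z'"
  unfolding upper_capacity_entropy_eq_SUP
proof (rule SUP_mono)
  fix \<epsilon> :: real assume "\<epsilon> \<in> {0<..}"
  then show "\<exists>\<epsilon>'\<in>{0<..}. limsup (growth Z \<epsilon>) \<le> limsup (growth Z' \<epsilon>')"
    using limsup_growth_mono[of \<epsilon> \<epsilon> Z Z'] assms by (intro bexI[of _ \<epsilon>]) auto
qed

text \<open>
  Each \<open>x \<in> E\<close> is encoded by a point \<open>w\<close> of a maximal separated subset of \<open>Z\<close> close to some \<open>z \<in> Z\<close> that
  follows the segment of \<open>x\<close>, by the time \<open>k\<close> at which \<open>z\<close> begins to do so, by the set \<open>D\<close> of error times,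
  and by the iterates of \<open>x\<close> at these times, rounded to the net \<open>A\<close>. Two points with the same code stay
  within \<open>4 * \<epsilon>\<close> of each other.
\<close>

lemma separated_count:
  fixes A Z E :: "'a set"
  assumes \<epsilon>: "\<epsilon> > 0" and n: "n > 0" and A: "finite A" "\<And>x. \<exists>p\<in>A. dist x p < 2 * \<epsilon>"
    and key: "\<And>x. \<exists>z\<in>Z. \<exists>k\<le>N. (T ^^ k) z \<in> blowup_ball T g n x \<epsilon>"
    and E: "separated T n (4 * \<epsilon>) E"
  shows "card E \<le> max_separated T (N + n) Z \<epsilon> * Suc N *
    card {D. D \<subseteq> {..<n} \<and> card D \<le> g n} * card A ^ g n"
proof -
  obtain F where F: "F \<subseteq> Z" "separated T (N + n) \<epsilon> F" "card F = max_separated T (N + n) Z \<epsilon>"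
    using max_separated_attained[of "N + n" \<epsilon> Z] \<epsilon> n by auto
  have finF: "finite F" using F(2) by (simp add: separated_def)
  have near: "\<exists>w\<in>F. \<forall>j<N + n. dist ((T ^^ j) z) ((T ^^ j) w) \<le> \<epsilon>" if z: "z \<in> Z" for z
  proof (rule ccontr)
    assume far: "\<not> ?thesis"
    then have "bowen_dist T (N + n) z w > \<epsilon> \<and> bowen_dist T (N + n) w z > \<epsilon>" if "w \<in> F" for w
      using that n bowen_dist_le_iff[of "N + n" T _ _ \<epsilon>] by (metis add_gr_0 dist_commute not_le)
    moreover from far \<epsilon> have "z \<notin> F" by force
    ultimately have "separated T (N + n) \<epsilon> (insert z F)" using F(2) by (auto simp: separated_def)
    from max_separated_ge[OF _ \<epsilon> _ this, of Z] have "card (insert z F) \<le> card F"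
      using F n z by auto
    then show False using \<open>z \<notin> F\<close> finF by simp
  qed
  define P where "P x w k D q \<longleftrightarrow> w \<in> F \<and> k \<le> N \<and> D \<subseteq> {..<n} \<and> card D \<le> g n \<and> q \<in> D \<rightarrow>\<^sub>E A \<and>
     (\<forall>j<n. j \<notin> D \<longrightarrow> dist ((T ^^ j) x) ((T ^^ (k + j)) w) \<le> 2 * \<epsilon>) \<and>
     (\<forall>j\<in>D. dist ((T ^^ j) x) (q j) \<le> 2 * \<epsilon>)" for x w k D and q :: "nat \<Rightarrow> 'a"
  have "\<exists>w k D q. P x w k D q" for x
  proof -
    obtain z k where z: "z \<in> Z" "k \<le> N" "(T ^^ k) z \<in> blowup_ball T g n x \<epsilon>" using key by blast
    from z(3) obtain \<Lambda> where \<Lambda>: "\<Lambda> \<subseteq> {..<n} \<and> card ({..<n} - \<Lambda>) \<le> g n \<and>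
        (\<forall>j\<in>\<Lambda>. dist ((T ^^ j) x) ((T ^^ j) ((T ^^ k) z)) \<le> \<epsilon>)"
      unfolding blowup_ball_def mem_Collect_eq ..
    obtain w where w: "w \<in> F" "\<And>j. j < N + n \<Longrightarrow> dist ((T ^^ j) z) ((T ^^ j) w) \<le> \<epsilon>"
      using near[OF z(1)] by blast
    obtain c where c: "\<And>y. c y \<in> A" "\<And>y. dist y (c y) < 2 * \<epsilon>" using A(2) by metis
    let ?D = "{..<n} - \<Lambda>" and ?q = "\<lambda>j\<in>{..<n} - \<Lambda>. c ((T ^^ j) x)"
    have "dist ((T ^^ j) x) ((T ^^ (k + j)) w) \<le> 2 * \<epsilon>" if j: "j < n" "j \<notin> ?D" for j
    proof -
      have "dist ((T ^^ j) x) ((T ^^ (k + j)) z) \<le> \<epsilon>"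
        using \<Lambda> j by (simp add: funpow_funpow)
      moreover have "dist ((T ^^ (k + j)) z) ((T ^^ (k + j)) w) \<le> \<epsilon>"
        using w(2) j(1) z(2) by simp
      ultimately show ?thesis
        using dist_triangle[of "(T ^^ j) x" "(T ^^ (k + j)) w" "(T ^^ (k + j)) z"] by linarith
    qed
    moreover have "dist ((T ^^ j) x) (?q j) \<le> 2 * \<epsilon>" if "j \<in> ?D" for j
      using that c(2) by (simp add: less_imp_le)
    ultimately have "P x w k ?D ?q" unfolding P_def using w(1) z(2) \<Lambda> c(1) by auto
    then show ?thesis by blast
  qed
  then obtain w k D q where Q: "\<And>x. P x (w x) (k x) (D x) (q x)" by metis
  let ?Ds = "{D. D \<subseteq> {..<n} \<and> card D \<le> g n}"
  let ?C = "F \<times> {..N} \<times> (SIGMA D:?Ds. D \<rightarrow>\<^sub>E A)"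
  have finDs: "finite ?Ds" by (rule finite_subset[of _ "Pow {..<n}"]) auto
  have finD: "finite D" if "D \<in> ?Ds" for D using that finite_subset by blast
  have finPi: "finite (D \<rightarrow>\<^sub>E A)" if "D \<in> ?Ds" for D
    using finD[OF that] A(1) by (intro finite_PiE)
  have "card E \<le> card ?C"
  proof (rule card_inj_on_le)
    show "(\<lambda>x. (w x, k x, D x, q x)) ` E \<subseteq> ?C"
    proof (rule image_subsetI)
      fix x
      show "(w x, k x, D x, q x) \<in> ?C" using Q[of x] unfolding P_def by simp
    qed
    have "finite (SIGMA D:?Ds. D \<rightarrow>\<^sub>E A)" by (rule finite_SigmaI[OF finDs finPi])
    then show "finite ?C" by (intro finite_cartesian_product finF finite_atMost)
    show "inj_on (\<lambda>x. (w x, k x, D x, q x)) E"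
    proof (rule inj_onI, rule ccontr)
      fix x y assume xy: "x \<in> E" "y \<in> E" "(w x, k x, D x, q x) = (w y, k y, D y, q y)" "x \<noteq> y"
      have "dist ((T ^^ j) x) ((T ^^ j) y) \<le> 4 * \<epsilon>" if "j < n" for j
      proof -
        have "\<exists>p. dist ((T ^^ j) x) p \<le> 2 * \<epsilon> \<and> dist ((T ^^ j) y) p \<le> 2 * \<epsilon>"
          using Q[of x] Q[of y] xy(3) that unfolding P_def by (cases "j \<in> D x") auto
        then obtain p where "dist ((T ^^ j) x) p \<le> 2 * \<epsilon>" "dist ((T ^^ j) y) p \<le> 2 * \<epsilon>" by blast
        then show ?thesis using dist_triangle2[of "(T ^^ j) x" "(T ^^ j) y" p] by linarith
      qed
      then have "bowen_dist T n x y \<le> 4 * \<epsilon>" using n by (simp add: bowen_dist_le_iff)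
      then show False using E xy by (force simp: separated_def)
    qed
  qed
  also have "card ?C = card F * (Suc N * (\<Sum>D\<in>?Ds. card A ^ card D))"
  proof -
    have "card (SIGMA D:?Ds. D \<rightarrow>\<^sub>E A) = (\<Sum>D\<in>?Ds. card (D \<rightarrow>\<^sub>E A))"
      by (rule card_SigmaI[OF finDs]) (intro ballI finPi)
    also have "\<dots> = (\<Sum>D\<in>?Ds. card A ^ card D)"
      by (intro sum.cong refl card_funcsetE finD)
    finally show ?thesis by (simp only: card_cartesian_product card_atMost)
  qed
  also have "(\<Sum>D\<in>?Ds. card A ^ card D) \<le> (\<Sum>D\<in>?Ds. card A ^ g n)"
    using A by (intro sum_mono power_increasing) (auto simp: Suc_le_eq card_gt_0_iff)
  also have "card F * (Suc N * (\<Sum>D\<in>?Ds. card A ^ g n)) =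
      max_separated T (N + n) Z \<epsilon> * Suc N * card ?Ds * card A ^ g n"
    by (simp add: F(3) algebra_simps)
  finally show ?thesis by (simp only: mult_le_mono le_refl)
qed

text \<open>
  Take logarithms in \<open>separated_count\<close> and divide by \<open>n\<close>. The error tends to \<open>\<theta>\<close>, which can be chosen
  smaller than any presumed gap \<open>c2 - c1\<close> between the two growth rates; the additional \<open>N\<close> iterates on
  the side of \<open>Z\<close> do not affect the rate.
\<close>

lemma entropy_lower_bound:
  fixes Z :: "'a set" and m :: "real \<Rightarrow> nat"
  assumes key: "\<And>\<epsilon> n x. \<epsilon> > 0 \<Longrightarrow> n \<ge> m \<epsilon> \<Longrightarrow> \<exists>z\<in>Z. \<exists>k\<le>N. (T ^^ k) z \<in> blowup_ball T g n x \<epsilon>"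
    and g: "(\<lambda>n. real (g n) / real n) \<longlonglongrightarrow> 0"
  shows "upper_capacity_entropy T UNIV \<le> upper_capacity_entropy T Z"
proof -
  have bound: "limsup (growth UNIV (4 * \<epsilon>)) \<le> limsup (growth Z \<epsilon>)" if \<epsilon>: "\<epsilon> > 0" for \<epsilon> :: real
  proof (rule ccontr)
    assume "\<not> ?thesis"
    then have "limsup (growth Z \<epsilon>) < limsup (growth UNIV (4 * \<epsilon>))" by simp
    from ereal_dense2[OF this] obtain c2 where
      c2: "limsup (growth Z \<epsilon>) < ereal c2" "ereal c2 < limsup (growth UNIV (4 * \<epsilon>))" by (elim exE conjE)
    from ereal_dense2[OF c2(1)] obtain c1 where
      c1: "limsup (growth Z \<epsilon>) < ereal c1" "ereal c1 < ereal c2" by (elim exE conjE)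
    have c12: "c1 < c2" using c1(2) by simp
    have arith: "s \<le> c2" if "a < c1 + d" "s \<le> a + e" "e + d < (c2 - c1) / 2" "c1 < c2" for s a d e :: real
      using that by argo
    define \<delta> where "\<delta> n = c1 * real N / real n" for n
    \<comment> \<open>the limit \<open>\<theta>\<close> of the error terms has to stay below half of the gap\<close>
    define \<theta> where "\<theta> = min 1 ((c2 - c1) / 4)"
    have \<theta>: "0 < \<theta>" "\<theta> \<le> 1" "\<theta> \<le> (c2 - c1) / 4"
    proof -
      show "0 < \<theta>" using c1(2) by (simp add: \<theta>_def)
    qed (unfold \<theta>_def, rule min.cobounded1, rule min.cobounded2)
    obtain A :: "'a set" where A: "finite A" "\<And>x. \<exists>p\<in>A. dist x p < 2 * \<epsilon>"
      using compact_finite_net[OF compact, of "2 * \<epsilon>"] \<epsilon> by auto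
    then have a: "card A > 0" by (auto simp: card_gt_0_iff)
    define s where "s n = max_separated T n UNIV (4 * \<epsilon>)" for n
    define t where "t n = max_separated T (N + n) Z \<epsilon>" for n
    define err where "err n = ln (Suc N) / n + \<theta> + g n / n * (ln (card A) - ln \<theta>)" for n
    have est: "t n > 0 \<and> ln (s n) / n \<le> ln (t n) / n + err n" if n: "n > 0" "n \<ge> m \<epsilon>" for n
    proof -
      obtain E :: "'a set" where E: "separated T n (4 * \<epsilon>) E" "card E = s n"
        using max_separated_attained[of n "4 * \<epsilon>" UNIV] n(1) \<epsilon> unfolding s_def by auto
      define d where "d = card {D. D \<subseteq> {..<n} \<and> card D \<le> g n}"
      have le: "s n \<le> t n * Suc N * d * card A ^ g n"
        unfolding t_def d_def E(2)[symmetric]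
        by (rule separated_count[OF \<epsilon> n(1) A key[OF \<epsilon> n(2)] E(1)])
      have "separated T n (4 * \<epsilon>) {undefined}" by (simp add: separated_def)
      from max_separated_ge[OF n(1) _ _ this, of UNIV] have s1: "s n \<ge> 1" using \<epsilon> by (simp add: s_def)
      then have pos: "t n > 0" "d > 0" using le by (auto intro!: Nat.gr0I)
      have "real (s n) \<le> real (t n * Suc N * d * card A ^ g n)" using le of_nat_le_iff by blast
      also have "\<dots> = real (t n) * real (Suc N) * real d * real (card A) ^ g n"
        by (simp only: of_nat_mult of_nat_power)
      finally have "ln (s n) \<le> ln (real (t n) * real (Suc N) * real d * real (card A) ^ g n)"
        using s1 by simp
      also have "\<dots> = ln (t n) + ln (Suc N) + ln d + g n * ln (card A)"
        using pos a by (simp add: ln_mult ln_realpow)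
      finally have 1: "ln (s n) \<le> ln (t n) + ln (Suc N) + ln d + g n * ln (card A)" .
      have "ln (real d * \<theta> ^ g n) \<le> ln ((1 + \<theta>) ^ n)"
        using card_small_subsets[OF \<theta>(1,2), of n "g n"] pos(2) \<theta>(1) by (simp flip: d_def)
      then have "ln d + g n * ln \<theta> \<le> n * ln (1 + \<theta>)"
        using pos(2) \<theta>(1) by (simp add: ln_mult ln_realpow)
      moreover have "n * ln (1 + \<theta>) \<le> n * \<theta>"
        using \<theta>(1) by (intro mult_left_mono ln_add_one_self_le_self) auto
      ultimately have "ln (s n) \<le> ln (t n) + ln (Suc N) + n * \<theta> + g n * (ln (card A) - ln \<theta>)"
        using 1 by (simp add: algebra_simps)
      then have "ln (s n) / n \<le> (ln (t n) + ln (Suc N) + n * \<theta> + g n * (ln (card A) - ln \<theta>)) / n"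
        by (rule divide_right_mono) simp
      also have "\<dots> = ln (t n) / n + err n"
        using n(1) by (simp add: err_def add_divide_distrib)
      finally show ?thesis using pos(1) by simp
    qed
    have "(\<lambda>n. err n + \<delta> n) \<longlonglongrightarrow> (0 + \<theta> + 0 * (ln (card A) - ln \<theta>)) + 0"
      unfolding err_def \<delta>_def by (intro tendsto_add tendsto_mult tendsto_const lim_const_over_n g)
    then have "\<forall>\<^sub>F n in sequentially. err n + \<delta> n < (c2 - c1) / 2"
      using \<theta> c1(2) by (intro order_tendstoD(2)) auto
    moreover have "\<forall>\<^sub>F n in sequentially. growth Z \<epsilon> (n + N) < c1"
      using Limsup_lessD[OF c1(1)] by (rule eventually_sequentially_seg[THEN iffD2])
    ultimately have "\<forall>\<^sub>F n in sequentially. growth UNIV (4 * \<epsilon>) n \<le> c2"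
      using eventually_gt_at_top[of 0] eventually_ge_at_top[of "m \<epsilon>"]
    proof eventually_elim
      case (elim n)
      have t: "t n > 0" "ln (s n) / n \<le> ln (t n) / n + err n" using est elim by auto
      have "1 / real (n + N) * ln (t n) < c1"
        using elim(2) t(1) by (simp add: growth_def t_def Let_def add.commute)
      then have "ln (t n) < c1 * (n + N)" using elim(3) by (simp add: divide_less_eq)
      then have "ln (t n) / n < c1 * (n + N) / n" using elim(3) by (simp add: divide_strict_right_mono)
      also have "\<dots> = c1 + \<delta> n" using elim(3) by (simp add: \<delta>_def field_simps)
      finally have "ln (s n) / n \<le> c2" by (rule arith[OF _ t(2) elim(1) c12])
      then show ?case by (simp add: growth_def Let_def flip: s_def)
    qed
    then have "limsup (growth UNIV (4 * \<epsilon>)) \<le> c2" by (rule Limsup_bounded)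
    then show False using c2(2) by simp
  qed
  show ?thesis
    unfolding upper_capacity_entropy_eq_SUP
  proof (rule SUP_mono)
    fix \<epsilon> :: real assume "\<epsilon> \<in> {0<..}"
    then show "\<exists>\<epsilon>'\<in>{0<..}. limsup (growth UNIV \<epsilon>) \<le> limsup (growth Z \<epsilon>')"
      using bound[of "\<epsilon> / 4"] by (intro bexI[of _ "\<epsilon> / 4"]) auto
  qed
qed

end

section \<open>Entropy of saturated sets\<close>

theorem theorem1p1:
  fixes T :: "'a::metric_space \<Rightarrow> 'a"
    and K :: "'a measure set"
  assumes "compact (UNIV :: 'a set)"
    and "continuous_on UNIV T"
    and "almost_product_property T"
    and "K \<subseteq> invariant_measures T"
    and "K \<noteq> {}"
    and "compactin weak_star K"
    and "connectedin weak_star K"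
  shows
    "(\<forall>U. open U \<and> U \<noteq> {} \<and> U \<inter> measure_center T \<noteq> {} \<longrightarrow>
        upper_capacity_entropy T (saturated_set T K \<inter> U \<inter> {x. measure_center T \<subseteq> omega_limit T x})
          = upper_capacity_entropy T (saturated_set T K \<inter> {x. measure_center T \<subseteq> omega_limit T x})
      \<and> upper_capacity_entropy T (saturated_set T K \<inter> {x. measure_center T \<subseteq> omega_limit T x})
          = upper_capacity_entropy T (saturated_set T K \<inter> U)
      \<and> upper_capacity_entropy T (saturated_set T K \<inter> U)
          = upper_capacity_entropy T (saturated_set T K)
      \<and> upper_capacity_entropy T (saturated_set T K) = topological_entropy T)
   \<and> ((\<exists>\<mu>\<in>invariant_measures T. supp \<mu> = UNIV) \<longrightarrow>
      (\<forall>U. open U \<and> U \<noteq> {} \<longrightarrow>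
        upper_capacity_entropy T (saturated_set T K \<inter> U)
          = upper_capacity_entropy T (saturated_set T K \<inter> transitive_points T \<inter> U)
      \<and> upper_capacity_entropy T (saturated_set T K \<inter> transitive_points T \<inter> U)
          = upper_capacity_entropy T (saturated_set T K)
      \<and> upper_capacity_entropy T (saturated_set T K)
          = upper_capacity_entropy T (saturated_set T K \<inter> transitive_points T)
      \<and> upper_capacity_entropy T (saturated_set T K \<inter> transitive_points T)
          = topological_entropy T))"
proof -
  have compact: "compact (UNIV :: 'a set)" by fact
  obtain g m where gm: "blowup g" "\<forall>k\<ge>2. \<forall>(x :: nat \<Rightarrow> 'a) (\<epsilon> :: nat \<Rightarrow> real) (n :: nat \<Rightarrow> nat).
      (\<forall>j\<in>{1..k}. \<epsilon> j > 0 \<and> n j \<ge> m (\<epsilon> j)) \<longrightarrow>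
      (\<Inter>j\<in>{1..k}. (T ^^ (\<Sum>i=1..j-1. n i)) -` blowup_ball T g (n j) (x j) (\<epsilon> j)) \<noteq> {}"
    using assms(3) unfolding almost_product_property_def by (elim exE conjE)
  obtain \<phi> :: "nat \<Rightarrow> 'a \<Rightarrow> real" where \<phi>: "weak_coordinates \<phi>"
    using weak_coordinates_exist[OF compact] ..
  interpret tracked_system T g m \<phi>
  proof (rule tracked_system.intro[OF almost_product.intro \<phi>])
    show "(\<Inter>j\<in>{1..k}. (T ^^ (\<Sum>i=1..j-1. n i)) -` blowup_ball T g (n j) (x j) (\<epsilon> j)) \<noteq> {}"
      if "k \<ge> 2" "\<forall>j\<in>{1..k}. \<epsilon> j > 0 \<and> n j \<ge> m (\<epsilon> j)" for k and x :: "nat \<Rightarrow> 'a" and \<epsilon> n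
      using gm(2) that by blast
  qed (fact compact, fact assms(2), fact gm(1))
  let ?h = "upper_capacity_entropy T" and ?G = "saturated_set T K"
    and ?\<Omega> = "{x. measure_center T \<subseteq> omega_limit T x}"
  note mono = upper_capacity_entropy_mono[OF compact, of _ _ T]
  have sandwich: "?h Z = topological_entropy T"
    if U: "open U" "U \<inter> measure_center T \<noteq> {}" and Z: "?G \<inter> U \<inter> ?\<Omega> \<subseteq> Z" for U Z
  proof (rule antisym)
    show "?h Z \<le> topological_entropy T" unfolding topological_entropy_def by (rule mono) simp
    obtain N where N: "\<forall>\<epsilon>>0. \<forall>n\<ge>m \<epsilon>. \<forall>x. \<exists>z\<in>?G \<inter> U \<inter> ?\<Omega>. \<exists>k\<le>N. (T ^^ k) z \<in> blowup_ball T g n x \<epsilon>"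
      using saturated_shadowing_points[OF assms(4-7) U] ..
    have "topological_entropy T \<le> ?h (?G \<inter> U \<inter> ?\<Omega>)"
      unfolding topological_entropy_def
      by (rule entropy_lower_bound[OF compact N[rule_format]])
        (use gm(1) in \<open>simp_all add: blowup_def\<close>)
    also have "\<dots> \<le> ?h Z" by (rule mono[OF Z])
    finally show "topological_entropy T \<le> ?h Z" .
  qed
  have transitive: "?\<Omega> \<subseteq> transitive_points T" if "measure_center T = UNIV"
  proof
    fix x assume "x \<in> ?\<Omega>"
    then have "omega_limit T x = UNIV" using that by blast
    moreover have "omega_limit T x \<subseteq> closure (range (\<lambda>n. (T ^^ n) x))"
      unfolding omega_limit_def by (rule INT_lower[THEN order.trans, of 0]) (auto intro!: closure_mono)
    ultimately show "x \<in> transitive_points T" unfolding transitive_points_def by blast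
  qed
  have center: "measure_center T = UNIV" if "\<mu> \<in> invariant_measures T" "supp \<mu> = UNIV" for \<mu>
  proof -
    have "(\<Union>\<mu>\<in>invariant_measures T. supp \<mu>) = UNIV" using that by blast
    then show ?thesis unfolding measure_center_def by simp
  qed
  show ?thesis
  proof (intro conjI allI impI)
    fix U :: "'a set" assume U: "open U \<and> U \<noteq> {} \<and> U \<inter> measure_center T \<noteq> {}"
    note eq = sandwich[OF conjunct1[OF U] conjunct2[OF conjunct2[OF U]]]
    have 1: "?h (?G \<inter> U \<inter> ?\<Omega>) = topological_entropy T" by (rule eq) blast
    have 2: "?h (?G \<inter> ?\<Omega>) = topological_entropy T" by (rule eq) blast
    have 3: "?h (?G \<inter> U) = topological_entropy T" by (rule eq) blast
    show 4: "?h ?G = topological_entropy T" by (rule eq) blast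
    show "?h (?G \<inter> U \<inter> ?\<Omega>) = ?h (?G \<inter> ?\<Omega>)" "?h (?G \<inter> ?\<Omega>) = ?h (?G \<inter> U)"
      "?h (?G \<inter> U) = ?h ?G" by (simp_all only: 1 2 3 4)
  next
    assume "\<exists>\<mu>\<in>invariant_measures T. supp \<mu> = UNIV"
    then have full: "measure_center T = UNIV" using center by blast
    fix U :: "'a set" assume U: "open U \<and> U \<noteq> {}"
    then have "U \<inter> measure_center T \<noteq> {}" by (simp add: full)
    note eq = sandwich[OF conjunct1[OF U] this]
    have 1: "?h (?G \<inter> U) = topological_entropy T" by (rule eq) blast
    have 2: "?h (?G \<inter> transitive_points T \<inter> U) = topological_entropy T"
      by (rule eq) (use transitive[OF full] in blast)
    have 3: "?h ?G = topological_entropy T" by (rule eq) blast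
    show 4: "?h (?G \<inter> transitive_points T) = topological_entropy T"
      by (rule eq) (use transitive[OF full] in blast)
    show "?h (?G \<inter> U) = ?h (?G \<inter> transitive_points T \<inter> U)"
      "?h (?G \<inter> transitive_points T \<inter> U) = ?h ?G" "?h ?G = ?h (?G \<inter> transitive_points T)"
      by (simp_all only: 1 2 3 4)
  qed
qed

end
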